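(* Let $L$ be a sectionally complemented modular lattice with a countable cofinal subset. Then $L$ has a Banaschewski trace. Hence $L$ embeds, as a neutral ideal and within the same quasivariety, into some complemented modular lattice; that is, there exist a complemented modular lattice $\tilde{L}$ belonging to every quasivariety of lattices that contains $L$, and a lattice embedding $\varepsilon\colon L\to\tilde{L}$ whose range is a neutral ideal of $\tilde{L}$.
   Context: "Countable" means at most countable. A subset $U$ of $L$ is cofinal if every element of $L$ is below some element of $U$. In a lattice with zero, $a\oplus b=c$ means $a\wedge b=0$ and $a\vee b=c$. A lattice $L$ with zero is sectionally complemented if for all $a\leq b$ in $L$ there exists $x\in L$ with $b=a\oplus x$. A lattice is complemented if it has $0$ and $1$ and every element has a complement. A Banaschewski trace on a lattice $L$ with zero is a family $(a_i^j\mid i\leq j\text{ in }\Lambda)$ of elements of $L$, where $\Lambda$ is an upward directed partially ordered set with least element $0$, such that (i) $a_i^k=a_i^j\oplus a_j^k$ for all $i\leq j\leq k$ in $\Lambda$; (ii) $\{a_0^i\mid i\in\Lambda\}$ is cofinal in $L$. An ideal of a lattice is a nonempty, upward directed, lower subset. An ideal $I$ of a lattice $M$ is neutral if $\{I,X,Y\}$ generates a distributive sublattice of the ideal lattice $\operatorname{Id}M$ for all ideals $X,Y$ of $M$. A quasivariety of lattices is a class of lattices defined by a set of quasi-identities (universally quantified Horn implications between equations in the language $(\vee,\wedge)$). *)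

theory Defs
  imports "HOL-Algebra.Lattice" "HOL-Library.Countable_Set"
begin

locale modular_lattice = lattice +
  assumes modular:
    "\<lbrakk>x \<in> carrier L; y \<in> carrier L; z \<in> carrier L; x \<sqsubseteq> z\<rbrakk>
      \<Longrightarrow> x \<squnion> (y \<sqinter> z) = (x \<squnion> y) \<sqinter> z"

text \<open>\<open>osum L a b c\<close> renders $a \oplus b = c$, a partial operation, as a ternary relation.\<close>

definition osum :: "('a, 'b) gorder_scheme \<Rightarrow> 'a \<Rightarrow> 'a \<Rightarrow> 'a \<Rightarrow> bool" where
  "osum L a b c \<longleftrightarrow> a \<sqinter>\<^bsub>L\<^esub> b = \<bottom>\<^bsub>L\<^esub> \<and> a \<squnion>\<^bsub>L\<^esub> b = c"

locale sectionally_complemented_lattice = lattice + weak_partial_order_bottom +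
  assumes sectional_complement:
    "\<lbrakk>a \<in> carrier L; b \<in> carrier L; a \<sqsubseteq> b\<rbrakk> \<Longrightarrow> \<exists>x\<in>carrier L. osum L a x b"

locale complemented_lattice = bounded_lattice +
  assumes complement:
    "a \<in> carrier L \<Longrightarrow> \<exists>x\<in>carrier L. a \<sqinter> x = \<bottom> \<and> a \<squnion> x = \<top>"

definition cofinal_subset :: "('a, 'b) gorder_scheme \<Rightarrow> 'a set \<Rightarrow> bool" where
  "cofinal_subset L U \<longleftrightarrow> U \<subseteq> carrier L \<and> (\<forall>x\<in>carrier L. \<exists>u\<in>U. x \<sqsubseteq>\<^bsub>L\<^esub> u)"

definition directed :: "('a, 'b) gorder_scheme \<Rightarrow> 'a set \<Rightarrow> bool" where
  "directed L D \<longleftrightarrow> (\<forall>x\<in>D. \<forall>y\<in>D. \<exists>z\<in>D. x \<sqsubseteq>\<^bsub>L\<^esub> z \<and> y \<sqsubseteq>\<^bsub>L\<^esub> z)"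

text \<open>\<open>a i j\<close> stands for $a_i^j$; its values for pairs with \<open>i \<sqsubseteq> j\<close> failing are irrelevant.\<close>

definition banaschewski_trace ::
    "('a, 'b) gorder_scheme \<Rightarrow> ('i, 'c) gorder_scheme \<Rightarrow> ('i \<Rightarrow> 'i \<Rightarrow> 'a) \<Rightarrow> bool" where
  "banaschewski_trace L \<Lambda> a \<longleftrightarrow>
     partial_order \<Lambda> \<and> weak_partial_order_bottom \<Lambda> \<and> directed \<Lambda> (carrier \<Lambda>) \<and>
     (\<forall>i\<in>carrier \<Lambda>. \<forall>j\<in>carrier \<Lambda>. i \<sqsubseteq>\<^bsub>\<Lambda>\<^esub> j \<longrightarrow> a i j \<in> carrier L) \<and>
     (\<forall>i\<in>carrier \<Lambda>. \<forall>j\<in>carrier \<Lambda>. \<forall>k\<in>carrier \<Lambda>.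
        i \<sqsubseteq>\<^bsub>\<Lambda>\<^esub> j \<longrightarrow> j \<sqsubseteq>\<^bsub>\<Lambda>\<^esub> k \<longrightarrow> osum L (a i j) (a j k) (a i k)) \<and>
     cofinal_subset L {a \<bottom>\<^bsub>\<Lambda>\<^esub> i |i. i \<in> carrier \<Lambda>}"

definition lattice_ideal :: "('a, 'b) gorder_scheme \<Rightarrow> 'a set \<Rightarrow> bool" where
  "lattice_ideal M I \<longleftrightarrow>
     I \<subseteq> carrier M \<and> I \<noteq> {} \<and> directed M I \<and>
     (\<forall>x\<in>I. \<forall>y\<in>carrier M. y \<sqsubseteq>\<^bsub>M\<^esub> x \<longrightarrow> y \<in> I)"

definition ideal_lattice :: "('a, 'b) gorder_scheme \<Rightarrow> 'a set gorder" where
  "ideal_lattice M = \<lparr>carrier = {I. lattice_ideal M I}, eq = (=), le = (\<subseteq>)\<rparr>"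

inductive_set generated_sublattice :: "('a, 'b) gorder_scheme \<Rightarrow> 'a set \<Rightarrow> 'a set"
  for L :: "('a, 'b) gorder_scheme" and A :: "'a set" where
  incl: "x \<in> A \<Longrightarrow> x \<in> generated_sublattice L A"
| join: "\<lbrakk>x \<in> generated_sublattice L A; y \<in> generated_sublattice L A\<rbrakk>
          \<Longrightarrow> x \<squnion>\<^bsub>L\<^esub> y \<in> generated_sublattice L A"
| meet: "\<lbrakk>x \<in> generated_sublattice L A; y \<in> generated_sublattice L A\<rbrakk>
          \<Longrightarrow> x \<sqinter>\<^bsub>L\<^esub> y \<in> generated_sublattice L A"

text \<open>Distributivity of a sublattice \<open>S\<close>, whose operations are the restrictions of those of \<open>L\<close>.\<close>

definition distributive_sublattice :: "('a, 'b) gorder_scheme \<Rightarrow> 'a set \<Rightarrow> bool" where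
  "distributive_sublattice L S \<longleftrightarrow>
     (\<forall>x\<in>S. \<forall>y\<in>S. \<forall>z\<in>S. x \<sqinter>\<^bsub>L\<^esub> (y \<squnion>\<^bsub>L\<^esub> z) = (x \<sqinter>\<^bsub>L\<^esub> y) \<squnion>\<^bsub>L\<^esub> (x \<sqinter>\<^bsub>L\<^esub> z))"

definition neutral_ideal :: "('a, 'b) gorder_scheme \<Rightarrow> 'a set \<Rightarrow> bool" where
  "neutral_ideal M I \<longleftrightarrow>
     lattice_ideal M I \<and>
     (\<forall>X Y. lattice_ideal M X \<longrightarrow> lattice_ideal M Y \<longrightarrow>
        distributive_sublattice (ideal_lattice M) (generated_sublattice (ideal_lattice M) {I, X, Y}))"

definition lattice_embedding ::
    "('a, 'c) gorder_scheme \<Rightarrow> ('b, 'd) gorder_scheme \<Rightarrow> ('a \<Rightarrow> 'b) \<Rightarrow> bool" where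
  "lattice_embedding L M f \<longleftrightarrow>
     f \<in> carrier L \<rightarrow> carrier M \<and> inj_on f (carrier L) \<and> join_pres L M f \<and> meet_pres L M f"

datatype lterm = Var nat | Join lterm lterm | Meet lterm lterm

primrec lterm_val :: "('a, 'b) gorder_scheme \<Rightarrow> (nat \<Rightarrow> 'a) \<Rightarrow> lterm \<Rightarrow> 'a" where
  "lterm_val L v (Var n) = v n"
| "lterm_val L v (Join s t) = lterm_val L v s \<squnion>\<^bsub>L\<^esub> lterm_val L v t"
| "lterm_val L v (Meet s t) = lterm_val L v s \<sqinter>\<^bsub>L\<^esub> lterm_val L v t"

text \<open>The finitely many premises (possibly none) of a quasi-identity, and its conclusion;
  a pair \<open>(s, t)\<close> stands for the equation \<open>s = t\<close>.\<close>

datatype quasi_identity = Quasi_Identity "(lterm \<times> lterm) list" "lterm \<times> lterm"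

definition eqn_holds :: "('a, 'b) gorder_scheme \<Rightarrow> (nat \<Rightarrow> 'a) \<Rightarrow> lterm \<times> lterm \<Rightarrow> bool" where
  "eqn_holds L v e \<longleftrightarrow> lterm_val L v (fst e) = lterm_val L v (snd e)"

primrec satisfies :: "('a, 'b) gorder_scheme \<Rightarrow> quasi_identity \<Rightarrow> bool" where
  "satisfies L (Quasi_Identity ps c) \<longleftrightarrow>
     (\<forall>v. range v \<subseteq> carrier L \<longrightarrow> (\<forall>p\<in>set ps. eqn_holds L v p) \<longrightarrow> eqn_holds L v c)"

text \<open>A class of lattices over all types is not a HOL object, so a quasivariety is given by a
  defining set \<open>Q\<close> of quasi-identities, and this is membership in it.\<close>

definition in_quasivariety :: "('a, 'b) gorder_scheme \<Rightarrow> quasi_identity set \<Rightarrow> bool" where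
  "in_quasivariety L Q \<longleftrightarrow> lattice L \<and> (\<forall>q\<in>Q. satisfies L q)"

end

theory Submission
  imports Defs
begin

text \<open>
  A countable cofinal subset yields an increasing sequence \<open>u 0 = \<bottom>, u 1, u 2, \<dots>\<close>
  that is cofinal in \<open>L\<close>.  If \<open>b n\<close> is a sectional complement of \<open>u n\<close> in \<open>u (Suc n)\<close>,
  then modularity makes the \<open>b n\<close> independent, and \<open>a i j = b i \<squnion> \<dots> \<squnion> b (j - 1)\<close> is a
  Banaschewski trace over the natural numbers, with \<open>a 0 n = u n\<close>.

  The sequence \<open>n \<mapsto> a 0 n\<close> behaves as a unit that \<open>L\<close> lacks, and \<open>n \<mapsto> a m n\<close> as a complement of
  \<open>a 0 m\<close>.  In the reduced power of \<open>L\<close> modulo the Frechet filter, take the germs of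
  the constant sequences \<open>x\<close> and of the sequences \<open>n \<mapsto> x \<squnion> a m n\<close> with \<open>x \<sqsubseteq> a 0 m\<close>:
  these are the ``finite'' and the ``cofinite'' elements.  Passing from stage \<open>m\<close> to a later stage \<open>k\<close>
  absorbs \<open>a m k\<close> into \<open>x\<close>, so any finite number of elements can be written at one stage
  (\<open>common_stage\<close>).  Since the interval below \<open>a 0 k\<close> is independent from \<open>a k n\<close>, there joins and
  meets are those of \<open>[\<bottom>, a 0 k] \<times> {finite, cofinite}\<close> (\<open>elt_join\<close>, \<open>elt_meet\<close>).  Hence these
  germs form a sublattice \<open>Ext\<close> of the reduced power; quasi-identities have only finitely many premises,
  so they pass to it.  A complement of \<open>x\<close> in \<open>a 0 k\<close>, made cofinite when \<open>x\<close> is finite and conversely, is a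
  complement in \<open>Ext\<close>.

  The finite elements form an ideal.  To see that it is neutral, it is enough to show that, in the
  ideal lattice of the modular lattice \<open>Ext\<close>, meets with it distribute over joins and joins with it
  distribute over meets (\<open>neutral_idealI\<close>); both are read off from representations at a common stage.
\<close>

section \<open>Lattice computations\<close>

context lattice
begin

lemma join_eqI:
  assumes "x \<in> carrier L" "y \<in> carrier L" "s \<in> carrier L" "x \<sqsubseteq> s" "y \<sqsubseteq> s"
    and "\<And>z. \<lbrakk>z \<in> carrier L; x \<sqsubseteq> z; y \<sqsubseteq> z\<rbrakk> \<Longrightarrow> s \<sqsubseteq> z"
  shows "x \<squnion> y = s"
  using assms by (intro le_antisym join_le assms(6) join_left join_right) auto

lemma meet_eqI:
  assumes "x \<in> carrier L" "y \<in> carrier L" "s \<in> carrier L" "s \<sqsubseteq> x" "s \<sqsubseteq> y"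
    and "\<And>z. \<lbrakk>z \<in> carrier L; z \<sqsubseteq> x; z \<sqsubseteq> y\<rbrakk> \<Longrightarrow> z \<sqsubseteq> s"
  shows "x \<sqinter> y = s"
  using assms by (intro le_antisym meet_le assms(6) meet_left meet_right) auto

lemma join_assoc:
  "\<lbrakk>x \<in> carrier L; y \<in> carrier L; z \<in> carrier L\<rbrakk> \<Longrightarrow> (x \<squnion> y) \<squnion> z = x \<squnion> (y \<squnion> z)"
  using weak_join_assoc by (simp add: eq_is_equal)

lemma meet_assoc:
  "\<lbrakk>x \<in> carrier L; y \<in> carrier L; z \<in> carrier L\<rbrakk> \<Longrightarrow> (x \<sqinter> y) \<sqinter> z = x \<sqinter> (y \<sqinter> z)"
  using weak_meet_assoc by (simp add: eq_is_equal)

lemma join_lcomm: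
  assumes "x \<in> carrier L" "y \<in> carrier L" "z \<in> carrier L"
  shows "x \<squnion> (y \<squnion> z) = y \<squnion> (x \<squnion> z)"
  using assms by (simp add: join_assoc[symmetric] join_comm[of L x y])

lemma meet_lcomm:
  assumes "x \<in> carrier L" "y \<in> carrier L" "z \<in> carrier L"
  shows "x \<sqinter> (y \<sqinter> z) = y \<sqinter> (x \<sqinter> z)"
  using assms by (simp add: meet_assoc[symmetric] meet_comm[of L x y])

lemma join_absorb:
  assumes "x \<sqsubseteq> y" "x \<in> carrier L" "y \<in> carrier L"
  shows "x \<squnion> y = y" "y \<squnion> x = y"
  using assms le_iff_meet[of x y] join_comm[of L y x] by simp_all

lemma meet_absorb:
  assumes "x \<sqsubseteq> y" "x \<in> carrier L" "y \<in> carrier L"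
  shows "x \<sqinter> y = x" "y \<sqinter> x = x"
  using assms le_iff_join[of x y] meet_comm[of L y x] by simp_all

lemma le_joinI1: "\<lbrakk>z \<sqsubseteq> x; x \<in> carrier L; y \<in> carrier L; z \<in> carrier L\<rbrakk> \<Longrightarrow> z \<sqsubseteq> x \<squnion> y"
  by (rule le_trans[OF _ join_left]) auto

lemma le_joinI2: "\<lbrakk>z \<sqsubseteq> y; x \<in> carrier L; y \<in> carrier L; z \<in> carrier L\<rbrakk> \<Longrightarrow> z \<sqsubseteq> x \<squnion> y"
  by (rule le_trans[OF _ join_right]) auto

lemma meet_leI1: "\<lbrakk>x \<sqsubseteq> z; x \<in> carrier L; y \<in> carrier L; z \<in> carrier L\<rbrakk> \<Longrightarrow> x \<sqinter> y \<sqsubseteq> z"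
  by (rule le_trans[OF meet_left]) auto

lemma meet_leI2: "\<lbrakk>y \<sqsubseteq> z; x \<in> carrier L; y \<in> carrier L; z \<in> carrier L\<rbrakk> \<Longrightarrow> x \<sqinter> y \<sqsubseteq> z"
  by (rule le_trans[OF meet_right]) auto

lemma join_mono:
  assumes "x \<sqsubseteq> x'" "y \<sqsubseteq> y'" "x \<in> carrier L" "y \<in> carrier L" "x' \<in> carrier L" "y' \<in> carrier L"
  shows "x \<squnion> y \<sqsubseteq> x' \<squnion> y'"
  using assms by (intro join_le le_joinI1[of x x' y'] le_joinI2[of y y' x']) auto

lemma meet_mono:
  assumes "x \<sqsubseteq> x'" "y \<sqsubseteq> y'" "x \<in> carrier L" "y \<in> carrier L" "x' \<in> carrier L" "y' \<in> carrier L"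
  shows "x \<sqinter> y \<sqsubseteq> x' \<sqinter> y'"
  using assms by (intro meet_le meet_leI1[of x x' y] meet_leI2[of y y' x]) auto

end

lemma latticeI:
  fixes K (structure)
  assumes eq: "(.=) = (=)"
    and refl: "\<And>x. x \<in> carrier K \<Longrightarrow> x \<sqsubseteq> x"
    and antisym: "\<And>x y. \<lbrakk>x \<in> carrier K; y \<in> carrier K; x \<sqsubseteq> y; y \<sqsubseteq> x\<rbrakk> \<Longrightarrow> x = y"
    and trans: "\<And>x y z. \<lbrakk>x \<in> carrier K; y \<in> carrier K; z \<in> carrier K; x \<sqsubseteq> y; y \<sqsubseteq> z\<rbrakk> \<Longrightarrow> x \<sqsubseteq> z"
    and sup: "\<And>x y. \<lbrakk>x \<in> carrier K; y \<in> carrier K\<rbrakk> \<Longrightarrow>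
      \<exists>s\<in>carrier K. x \<sqsubseteq> s \<and> y \<sqsubseteq> s \<and> (\<forall>z\<in>carrier K. x \<sqsubseteq> z \<longrightarrow> y \<sqsubseteq> z \<longrightarrow> s \<sqsubseteq> z)"
    and inf: "\<And>x y. \<lbrakk>x \<in> carrier K; y \<in> carrier K\<rbrakk> \<Longrightarrow>
      \<exists>s\<in>carrier K. s \<sqsubseteq> x \<and> s \<sqsubseteq> y \<and> (\<forall>z\<in>carrier K. z \<sqsubseteq> x \<longrightarrow> z \<sqsubseteq> y \<longrightarrow> z \<sqsubseteq> s)"
  shows "lattice K"
proof -
  have po: "partial_order K"
    by unfold_locales (simp_all add: eq refl, (blast intro: antisym, blast intro: trans))
  show ?thesis
  proof (intro lattice.intro upper_semilattice.intro lower_semilattice.intro po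
      upper_semilattice_axioms.intro lower_semilattice_axioms.intro)
    fix x y assume xy: "x \<in> carrier K" "y \<in> carrier K"
    show "\<exists>s. least K s (Upper K {x, y})"
      using sup[OF xy] xy unfolding least_def Upper_def by blast
    show "\<exists>s. greatest K s (Lower K {x, y})"
      using inf[OF xy] xy unfolding greatest_def Lower_def by blast
  qed
qed

lemma (in weak_partial_order_bottom) bottom_unique:
  assumes "partial_order L" "b \<in> carrier L" "\<And>x. x \<in> carrier L \<Longrightarrow> b \<sqsubseteq> x"
  shows "\<bottom> = b"
  using assms partial_order.le_antisym[OF assms(1)] bottom_closed bottom_lower by blast

locale bounded_below_modular_lattice = modular_lattice + weak_partial_order_bottom
begin

lemma join_bottom [simp]: "x \<in> carrier L \<Longrightarrow> x \<squnion> \<bottom> = x" "x \<in> carrier L \<Longrightarrow> \<bottom> \<squnion> x = x"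
  by (simp_all add: join_absorb)

lemma meet_bottom [simp]: "x \<in> carrier L \<Longrightarrow> x \<sqinter> \<bottom> = \<bottom>" "x \<in> carrier L \<Longrightarrow> \<bottom> \<sqinter> x = \<bottom>"
  by (simp_all add: meet_absorb)

text \<open>If \<open>p\<close> and \<open>q\<close> are independent, the sublattice generated by the intervals below them is
  their product.  This rests on Dedekind's transposition principle: adding \<open>q\<close> is an isomorphism
  of the interval below \<open>p\<close> onto the one from \<open>q\<close> to \<open>p \<squnion> q\<close>, and symmetrically for \<open>p\<close>.\<close>

lemma independent_meet_join:
  assumes c: "p \<in> carrier L" "q \<in> carrier L" "x \<in> carrier L" "y \<in> carrier L" "u \<in> carrier L" "v \<in> carrier L"
    and pq: "p \<sqinter> q = \<bottom>" and le: "x \<sqsubseteq> p" "y \<sqsubseteq> p" "u \<sqsubseteq> q" "v \<sqsubseteq> q"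
  shows "(x \<squnion> u) \<sqinter> (y \<squnion> v) = (x \<sqinter> y) \<squnion> (u \<sqinter> v)"
proof (rule le_antisym)
  let ?z = "(x \<squnion> u) \<sqinter> (y \<squnion> v)"
  \<comment> \<open>Meeting with \<open>a\<close> undoes adding \<open>b\<close>, so adding \<open>b\<close> preserves meets below \<open>a\<close>.\<close>
  have proj: "(r \<squnion> b) \<sqinter> a = r"
    if "a \<in> carrier L" "b \<in> carrier L" "r \<in> carrier L" "r \<sqsubseteq> a" "a \<sqinter> b = \<bottom>" for a b r
    using modular[of r b a] that by (simp add: meet_comm)
  have shift: "(r \<squnion> b) \<sqinter> (s \<squnion> b) = (r \<sqinter> s) \<squnion> b"
    if *: "a \<in> carrier L" "b \<in> carrier L" "r \<in> carrier L" "s \<in> carrier L"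
      "r \<sqsubseteq> a" "s \<sqsubseteq> a" "a \<sqinter> b = \<bottom>" for a b r s
  proof -
    have "(r \<squnion> b) \<sqinter> (s \<squnion> b) = b \<squnion> (s \<sqinter> (r \<squnion> b))"
      using modular[of b s "r \<squnion> b"] * join_right[of r b] by (simp add: meet_comm join_comm)
    also have "s \<sqinter> (r \<squnion> b) = s \<sqinter> (a \<sqinter> (r \<squnion> b))"
      using * meet_absorb(1)[of s a] by (simp add: meet_assoc[symmetric])
    also have "\<dots> = r \<sqinter> s" using proj[of a b r] * by (simp add: meet_comm)
    finally show ?thesis using * by (simp add: join_comm)
  qed
  have "?z \<sqsubseteq> (x \<squnion> q) \<sqinter> (y \<squnion> q)"
    using c le by (intro meet_mono join_mono) auto
  also have "\<dots> = (x \<sqinter> y) \<squnion> q" using shift[of p q x y] c le pq by simp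
  finally have 1: "?z \<sqsubseteq> (x \<sqinter> y) \<squnion> q" using c by simp
  have "?z \<sqsubseteq> (u \<squnion> p) \<sqinter> (v \<squnion> p)"
    unfolding join_comm[of L x u] join_comm[of L y v]
    using c le by (intro meet_mono join_mono) auto
  also have "\<dots> = (u \<sqinter> v) \<squnion> p" using shift[of q p u v] c le pq by (simp add: meet_comm)
  finally have 2: "?z \<sqsubseteq> (u \<sqinter> v) \<squnion> p" using c by simp
  \<comment> \<open>Modularity applies because \<open>x \<sqinter> y \<sqsubseteq> p\<close>; the remaining meet with \<open>q\<close> cancels \<open>p\<close>.\<close>
  have "?z \<sqsubseteq> ((x \<sqinter> y) \<squnion> q) \<sqinter> ((u \<sqinter> v) \<squnion> p)" using 1 2 c by (intro meet_le) auto
  also have "\<dots> = (x \<sqinter> y) \<squnion> (q \<sqinter> ((u \<sqinter> v) \<squnion> p))"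
    using c le by (intro modular[symmetric] le_joinI2 meet_leI1) auto
  also have "q \<sqinter> ((u \<sqinter> v) \<squnion> p) = u \<sqinter> v"
    using proj[of q p "u \<sqinter> v"] c le pq by (simp add: meet_comm meet_leI1)
  finally show "?z \<sqsubseteq> (x \<sqinter> y) \<squnion> (u \<sqinter> v)" using c by simp
  show "(x \<sqinter> y) \<squnion> (u \<sqinter> v) \<sqsubseteq> ?z"
    using c by (intro meet_le join_mono meet_left meet_right) auto
qed (use c in auto)

end

section \<open>Banaschewski traces indexed by the natural numbers\<close>

definition nat_order :: "nat gorder" where
  "nat_order = \<lparr>carrier = UNIV, eq = (=), le = (\<le>)\<rparr>"

lemma nat_order_simps [simp]:
  "carrier nat_order = UNIV" "(m \<sqsubseteq>\<^bsub>nat_order\<^esub> n) = (m \<le> n)" "eq nat_order = (=)"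
  by (simp_all add: nat_order_def)

lemma partial_order_nat_order: "partial_order nat_order"
  by unfold_locales auto

lemma bottom_nat_order: "weak_partial_order_bottom nat_order" "\<bottom>\<^bsub>nat_order\<^esub> = 0"
proof -
  show bot: "weak_partial_order_bottom nat_order"
    using partial_order_nat_order
    by (intro weak_partial_order_bottom.intro weak_partial_order_bottom_axioms.intro exI[of _ 0])
      (auto simp: partial_order_def least_def)
  show "\<bottom>\<^bsub>nat_order\<^esub> = 0"
    by (rule weak_partial_order_bottom.bottom_unique[OF bot partial_order_nat_order]) auto
qed

lemma banaschewski_trace_nat_order:
  "banaschewski_trace L nat_order a \<longleftrightarrow>
     (\<forall>i j. i \<le> j \<longrightarrow> a i j \<in> carrier L) \<and>
     (\<forall>i j k. i \<le> j \<longrightarrow> j \<le> k \<longrightarrow> osum L (a i j) (a j k) (a i k)) \<and>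
     (\<forall>x\<in>carrier L. \<exists>n. x \<sqsubseteq>\<^bsub>L\<^esub> a 0 n)"
proof -
  have "directed nat_order UNIV"
    unfolding directed_def by (auto intro: max.cobounded1 max.cobounded2)
  moreover have "cofinal_subset L {a 0 i |i. i \<in> UNIV} \<longleftrightarrow>
      range (a 0) \<subseteq> carrier L \<and> (\<forall>x\<in>carrier L. \<exists>n. x \<sqsubseteq>\<^bsub>L\<^esub> a 0 n)"
    unfolding cofinal_subset_def by blast
  ultimately show ?thesis
    unfolding banaschewski_trace_def using partial_order_nat_order bottom_nat_order by auto
qed

text \<open>The index of \<open>b\<close> runs over the half-open interval from \<open>i\<close> to \<open>j\<close>.  The value for \<open>i = j\<close> is
  the empty join \<open>\<bottom>\<close>, as it must be in a trace.\<close>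

fun joins_between :: "('a, 'b) gorder_scheme \<Rightarrow> (nat \<Rightarrow> 'a) \<Rightarrow> nat \<Rightarrow> nat \<Rightarrow> 'a" where
  "joins_between L b i 0 = \<bottom>\<^bsub>L\<^esub>"
| "joins_between L b i (Suc j) =
     (if i \<le> j then joins_between L b i j \<squnion>\<^bsub>L\<^esub> b j else \<bottom>\<^bsub>L\<^esub>)"

text \<open>A new complement \<open>b k\<close> is independent from \<open>u k\<close>, which lies above \<open>u j\<close> and above the join of
  \<open>b j, \<dots>, b (k - 1)\<close>.  So adding \<open>b k\<close> to the latter does not change its meet with \<open>u j\<close>, which
  stays \<open>\<bottom>\<close> as \<open>k\<close> grows.\<close>

lemma (in bounded_below_modular_lattice) trace_of_increasing_sequence:
  assumes u: "\<And>n. u n \<in> carrier L" "u 0 = \<bottom>" and b: "\<And>n. b n \<in> carrier L"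
    and step: "\<And>n. osum L (u n) (b n) (u (Suc n))"
    and cof: "\<And>x. x \<in> carrier L \<Longrightarrow> \<exists>n. x \<sqsubseteq> u n"
  shows "banaschewski_trace L nat_order (joins_between L b)"
proof -
  let ?a = "joins_between L b"
  have closed: "?a i j \<in> carrier L" for i j by (induction j) (auto simp: b)
  have 0: "?a 0 n = u n" for n
    by (induction n) (use step u in \<open>auto simp: osum_def\<close>)
  have diag: "?a i i = \<bottom>" for i by (cases i) auto
  have join: "?a i j \<squnion> ?a j k = ?a i k" if "i \<le> j" "j \<le> k" for i j k
    using \<open>j \<le> k\<close>
    by (induction k rule: dec_induct)
      (use that in \<open>auto simp: diag closed b join_assoc[symmetric]\<close>)
  have le: "?a j k \<sqsubseteq> u k" if "j \<le> k" for j k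
    using join[of 0 j k] that join_right[of "?a 0 j" "?a j k"] by (simp add: 0 closed u)
  have meet0: "u j \<sqinter> ?a j k = \<bottom>" if "j \<le> k" for j k
    using that
  proof (induction k rule: dec_induct)
    case base
    then show ?case by (simp add: diag u)
  next
    case (step k)
    have "u j \<sqsubseteq> u k"
      using join[of 0 j k] \<open>j \<le> k\<close> join_left[of "?a 0 j" "?a j k"] by (simp add: 0 closed u)
    then have "(u j \<squnion> \<bottom>) \<sqinter> (?a j k \<squnion> b k) = (u j \<sqinter> ?a j k) \<squnion> (\<bottom> \<sqinter> b k)"
      using assms(4)[of k] le[OF \<open>j \<le> k\<close>]
      by (intro independent_meet_join[of "u k" "b k"]) (auto simp: osum_def u b closed)
    then show ?case using step by (simp add: u b closed)
  qed
  have "osum L (?a i j) (?a j k) (?a i k)" if "i \<le> j" "j \<le> k" for i j k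
  proof -
    have "?a i j \<sqinter> ?a j k \<sqsubseteq> u j \<sqinter> ?a j k"
      using le[OF \<open>i \<le> j\<close>] by (intro meet_mono) (auto simp: u closed)
    then have "?a i j \<sqinter> ?a j k = \<bottom>"
      using meet0[OF \<open>j \<le> k\<close>] by (intro le_antisym) (auto simp: closed)
    then show ?thesis using join that by (simp add: osum_def)
  qed
  then show ?thesis using cof closed by (auto simp: banaschewski_trace_nat_order 0)
qed

lemma banaschewski_trace_exists:
  fixes L (structure)
  assumes "sectionally_complemented_lattice L" "modular_lattice L"
    and "countable U" "cofinal_subset L U"
  shows "\<exists>a. banaschewski_trace L nat_order a"
proof -
  interpret sectionally_complemented_lattice L by fact
  interpret bounded_below_modular_lattice L
    using assms(2) by (intro bounded_below_modular_lattice.intro weak_partial_order_bottom_axioms)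
  have U: "U \<subseteq> carrier L" "\<And>x. x \<in> carrier L \<Longrightarrow> \<exists>u\<in>U. x \<sqsubseteq> u"
    using assms(4) by (auto simp: cofinal_subset_def)
  define e where "e = from_nat_into U"
  have "U \<noteq> {}" using U(2)[OF bottom_closed] by auto
  then have e: "range e = U" using range_from_nat_into[OF _ assms(3)] by (simp add: e_def)
  define u where "u = rec_nat \<bottom> (\<lambda>n v. v \<squnion> e n)"
  have u_simps: "u 0 = \<bottom>" "u (Suc n) = u n \<squnion> e n" for n by (simp_all add: u_def)
  have e_closed: "e n \<in> carrier L" for n using e U(1) by auto
  have u_closed: "u n \<in> carrier L" for n by (induction n) (auto simp: u_simps e_closed)
  have "\<exists>b\<in>carrier L. osum L (u n) b (u (Suc n))" for n
    by (rule sectional_complement) (auto simp: u_closed e_closed u_simps join_left)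
  then obtain b where b: "\<And>n. b n \<in> carrier L" "\<And>n. osum L (u n) (b n) (u (Suc n))" by metis
  have "\<exists>n. x \<sqsubseteq> u n" if x: "x \<in> carrier L" for x
  proof -
    obtain n where "x \<sqsubseteq> e n" using U(2)[OF x] unfolding e[symmetric] by auto
    then have "x \<sqsubseteq> u (Suc n)" unfolding u_simps using x by (intro le_joinI2 e_closed u_closed)
    then show ?thesis ..
  qed
  then have "banaschewski_trace L nat_order (joins_between L b)"
    using u_closed b by (intro trace_of_increasing_sequence[of u]) (auto simp: u_simps(1))
  then show ?thesis by (intro exI)
qed

section \<open>Neutral ideals of modular lattices\<close>

context lattice
begin

text \<open>Two elements generate a distributive lattice with at most four elements, and adjoining a least or
  a greatest element keeps it distributive.  The carrier is listed explicitly so that memberships can be propagated through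
  the induction that defines a generated sublattice.\<close>

lemma two_generated_sublattice_with_bound:
  fixes e p q
  defines "D \<equiv> {e, p, q, p \<sqinter> q, p \<squnion> q}"
  assumes c: "e \<in> carrier L" "p \<in> carrier L" "q \<in> carrier L"
    and e: "p \<sqsubseteq> e \<and> q \<sqsubseteq> e \<or> e \<sqsubseteq> p \<and> e \<sqsubseteq> q"
  shows "\<lbrakk>x \<in> D; y \<in> D\<rbrakk> \<Longrightarrow> x \<squnion> y \<in> D" "\<lbrakk>x \<in> D; y \<in> D\<rbrakk> \<Longrightarrow> x \<sqinter> y \<in> D"
    and "distributive_sublattice L D"
proof -
  have idem: "x \<squnion> x = x" "x \<sqinter> x = x" if "x \<in> carrier L" for x
    using that by (simp_all add: join_absorb meet_absorb)
  have pq: "p \<sqinter> q \<sqsubseteq> p" "p \<sqinter> q \<sqsubseteq> q" "p \<sqsubseteq> p \<squnion> q" "q \<sqsubseteq> p \<squnion> q" "p \<sqinter> q \<sqsubseteq> p \<squnion> q"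
    using c by (auto intro: meet_left meet_right join_left join_right meet_leI1 le_joinI1)
  note tab = idem join_absorb[OF pq(1)] join_absorb[OF pq(2)] join_absorb[OF pq(3)]
    join_absorb[OF pq(4)] join_absorb[OF pq(5)]
    meet_absorb[OF pq(1)] meet_absorb[OF pq(2)] meet_absorb[OF pq(3)]
    meet_absorb[OF pq(4)] meet_absorb[OF pq(5)] join_comm[of L q p] meet_comm[of L q p]
  consider "\<forall>x\<in>D. x \<sqsubseteq> e" | "\<forall>x\<in>D. e \<sqsubseteq> x"
    using e c unfolding D_def by (auto intro: meet_leI1 le_joinI1 join_le meet_le)
  then have "(\<forall>x\<in>D. \<forall>y\<in>D. x \<squnion> y \<in> D \<and> x \<sqinter> y \<in> D) \<and> distributive_sublattice L D"
  proof cases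
    case 1
    then have "x \<squnion> e = e" "e \<squnion> x = e" "x \<sqinter> e = x" "e \<sqinter> x = x" if "x \<in> D" for x
      using that c by (auto simp: D_def intro!: join_absorb meet_absorb)
    then show ?thesis unfolding distributive_sublattice_def D_def using c
      by (simp add: tab)
  next
    case 2
    then have "x \<squnion> e = x" "e \<squnion> x = x" "x \<sqinter> e = e" "e \<sqinter> x = e" if "x \<in> D" for x
      using that c by (auto simp: D_def intro!: join_absorb meet_absorb)
    then show ?thesis unfolding distributive_sublattice_def D_def using c
      by (simp add: tab)
  qed
  then show "\<lbrakk>x \<in> D; y \<in> D\<rbrakk> \<Longrightarrow> x \<squnion> y \<in> D" "\<lbrakk>x \<in> D; y \<in> D\<rbrakk> \<Longrightarrow> x \<sqinter> y \<in> D"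
    "distributive_sublattice L D" by blast+
qed

lemma generated_sublattice_closed:
  "A \<subseteq> carrier L \<Longrightarrow> z \<in> generated_sublattice L A \<Longrightarrow> z \<in> carrier L"
  by (erule generated_sublattice.induct) auto

text \<open>By \<open>dist\<close> and \<open>codist\<close>, the maps \<open>z \<mapsto> e \<sqinter> z\<close> and \<open>z \<mapsto> e \<squnion> z\<close> are homomorphisms; they send
  \<open>e\<close> to a bound of the images of \<open>p\<close> and \<open>q\<close>.  So they map the sublattice generated by
  \<open>{e, p, q}\<close> into two distributive lattices.  One side of the distributive law is always below the other, so \<open>cancel\<close>
  pulls the law back.\<close>

lemma neutral_element_generates_distributive:
  assumes c: "e \<in> carrier L" "p \<in> carrier L" "q \<in> carrier L"
    and dist: "\<And>x y. \<lbrakk>x \<in> carrier L; y \<in> carrier L\<rbrakk> \<Longrightarrow> e \<sqinter> (x \<squnion> y) = (e \<sqinter> x) \<squnion> (e \<sqinter> y)"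
    and codist: "\<And>x y. \<lbrakk>x \<in> carrier L; y \<in> carrier L\<rbrakk> \<Longrightarrow> e \<squnion> (x \<sqinter> y) = (e \<squnion> x) \<sqinter> (e \<squnion> y)"
    and cancel: "\<And>x y. \<lbrakk>x \<in> carrier L; y \<in> carrier L; x \<sqsubseteq> y; e \<sqinter> x = e \<sqinter> y; e \<squnion> x = e \<squnion> y\<rbrakk> \<Longrightarrow> x = y"
  shows "distributive_sublattice L (generated_sublattice L {e, p, q})"
proof -
  let ?G = "generated_sublattice L {e, p, q}"
  have idem: "e \<squnion> e = e" "e \<sqinter> e = e" using c by (simp_all add: join_absorb meet_absorb)
  have Gc: "z \<in> carrier L" if "z \<in> ?G" for z
    using generated_sublattice_closed[OF _ that] c by simp
  have dist': "e \<sqinter> (x \<sqinter> y) = (e \<sqinter> x) \<sqinter> (e \<sqinter> y)" if "x \<in> carrier L" "y \<in> carrier L" for x y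
    using that c idem meet_assoc[of e x "e \<sqinter> y"] meet_lcomm[of x e y]
      meet_assoc[of e e "x \<sqinter> y"] by simp
  have codist': "e \<squnion> (x \<squnion> y) = (e \<squnion> x) \<squnion> (e \<squnion> y)" if "x \<in> carrier L" "y \<in> carrier L" for x y
    using that c idem join_assoc[of e x "e \<squnion> y"] join_lcomm[of x e y]
      join_assoc[of e e "x \<squnion> y"] by simp
  let ?D = "{e, e \<sqinter> p, e \<sqinter> q, (e \<sqinter> p) \<sqinter> (e \<sqinter> q), (e \<sqinter> p) \<squnion> (e \<sqinter> q)}"
  let ?E = "{e, e \<squnion> p, e \<squnion> q, (e \<squnion> p) \<sqinter> (e \<squnion> q), (e \<squnion> p) \<squnion> (e \<squnion> q)}"
  note D = two_generated_sublattice_with_bound[of e "e \<sqinter> p" "e \<sqinter> q"]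
  note E = two_generated_sublattice_with_bound[of e "e \<squnion> p" "e \<squnion> q"]
  have GD: "e \<sqinter> z \<in> ?D" if "z \<in> ?G" for z
    using that
  proof (induction rule: generated_sublattice.induct)
    case (join x y)
    then show ?case using D(1)[of "e \<sqinter> x" "e \<sqinter> y"] c Gc by (simp add: dist meet_left)
  next
    case (meet x y)
    then show ?case using D(2)[of "e \<sqinter> x" "e \<sqinter> y"] c Gc by (simp add: dist' meet_left)
  qed (auto simp: idem)
  have GE: "e \<squnion> z \<in> ?E" if "z \<in> ?G" for z
    using that
  proof (induction rule: generated_sublattice.induct)
    case (join x y)
    then show ?case using E(1)[of "e \<squnion> x" "e \<squnion> y"] c Gc by (simp add: codist' join_left)
  next
    case (meet x y)
    then show ?case using E(2)[of "e \<squnion> x" "e \<squnion> y"] c Gc by (simp add: codist join_left)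
  qed (auto simp: idem)
  have Dd: "distributive_sublattice L ?D" and Ed: "distributive_sublattice L ?E"
    using D(3) E(3) c by (simp_all add: meet_left join_left)
  show ?thesis unfolding distributive_sublattice_def
  proof (intro ballI)
    fix x y z assume G: "x \<in> ?G" "y \<in> ?G" "z \<in> ?G"
    note [simp] = Gc[OF G(1)] Gc[OF G(2)] Gc[OF G(3)] c
    have "(x \<sqinter> y) \<squnion> (x \<sqinter> z) = x \<sqinter> (y \<squnion> z)"
    proof (rule cancel)
      show "(x \<sqinter> y) \<squnion> (x \<sqinter> z) \<sqsubseteq> x \<sqinter> (y \<squnion> z)"
        by (intro meet_le join_le meet_left meet_mono join_left join_right le_refl) auto
      show "e \<sqinter> ((x \<sqinter> y) \<squnion> (x \<sqinter> z)) = e \<sqinter> (x \<sqinter> (y \<squnion> z))"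
        using Dd[unfolded distributive_sublattice_def, rule_format, OF GD GD GD, OF G]
        by (simp only: dist dist' Gc[OF G(1)] Gc[OF G(2)] Gc[OF G(3)] meet_closed join_closed)
      show "e \<squnion> ((x \<sqinter> y) \<squnion> (x \<sqinter> z)) = e \<squnion> (x \<sqinter> (y \<squnion> z))"
        using Ed[unfolded distributive_sublattice_def, rule_format, OF GE GE GE, OF G]
        by (simp only: codist codist' Gc[OF G(1)] Gc[OF G(2)] Gc[OF G(3)] meet_closed join_closed)
    qed auto
    then show "x \<sqinter> (y \<squnion> z) = (x \<sqinter> y) \<squnion> (x \<sqinter> z)" ..
  qed
qed

end

definition ideal_sup :: "('a, 'b) gorder_scheme \<Rightarrow> 'a set \<Rightarrow> 'a set \<Rightarrow> 'a set" where
  "ideal_sup L X Y = {z \<in> carrier L. \<exists>x\<in>X. \<exists>y\<in>Y. z \<sqsubseteq>\<^bsub>L\<^esub> x \<squnion>\<^bsub>L\<^esub> y}"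

lemma ideal_supI:
  fixes L (structure)
  shows "\<lbrakk>z \<in> carrier L; x \<in> X; y \<in> Y; z \<sqsubseteq> x \<squnion> y\<rbrakk> \<Longrightarrow> z \<in> ideal_sup L X Y"
  unfolding ideal_sup_def by blast

lemma ideal_lattice_simps [simp]:
  "carrier (ideal_lattice M) = Collect (lattice_ideal M)"
  "(X \<sqsubseteq>\<^bsub>ideal_lattice M\<^esub> Y) = (X \<subseteq> Y)"
  "eq (ideal_lattice M) = (=)"
  by (simp_all add: ideal_lattice_def)

context lattice
begin

lemma ideal_carrier: "\<lbrakk>lattice_ideal L I; x \<in> I\<rbrakk> \<Longrightarrow> x \<in> carrier L"
  by (auto simp: lattice_ideal_def)

lemma ideal_downward: "\<lbrakk>lattice_ideal L I; x \<in> I; y \<in> carrier L; y \<sqsubseteq> x\<rbrakk> \<Longrightarrow> y \<in> I"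
  by (auto simp: lattice_ideal_def)

lemma ideal_nonempty: "lattice_ideal L I \<Longrightarrow> \<exists>x. x \<in> I"
  by (auto simp: lattice_ideal_def)

lemma ideal_join:
  assumes I: "lattice_ideal L I" and xy: "x \<in> I" "y \<in> I"
  shows "x \<squnion> y \<in> I"
proof -
  obtain z where z: "z \<in> I" "x \<sqsubseteq> z" "y \<sqsubseteq> z"
    using I xy unfolding lattice_ideal_def directed_def by blast
  then show ?thesis
    using ideal_carrier[OF I] xy by (intro ideal_downward[OF I z(1)] join_le) auto
qed

lemma lattice_idealI:
  assumes "I \<subseteq> carrier L" "x \<in> I" "\<And>x y. \<lbrakk>x \<in> I; y \<in> I\<rbrakk> \<Longrightarrow> x \<squnion> y \<in> I"
    and "\<And>x y. \<lbrakk>x \<in> I; y \<in> carrier L; y \<sqsubseteq> x\<rbrakk> \<Longrightarrow> y \<in> I"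
  shows "lattice_ideal L I"
proof -
  have "directed L I" unfolding directed_def
  proof (intro ballI)
    fix x y assume xy: "x \<in> I" "y \<in> I"
    then have "x \<sqsubseteq> x \<squnion> y" "y \<sqsubseteq> x \<squnion> y" using assms(1) by (auto intro: join_left join_right)
    then show "\<exists>z\<in>I. x \<sqsubseteq> z \<and> y \<sqsubseteq> z" using assms(3)[OF xy] by blast
  qed
  then show ?thesis using assms unfolding lattice_ideal_def by blast
qed

lemma ideal_inter:
  assumes X: "lattice_ideal L X" and Y: "lattice_ideal L Y"
  shows "lattice_ideal L (X \<inter> Y)"
proof -
  obtain x y where xy: "x \<in> X" "y \<in> Y" using ideal_nonempty X Y by meson
  note c = ideal_carrier[OF X xy(1)] ideal_carrier[OF Y xy(2)]
  show ?thesis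
  proof (rule lattice_idealI)
    show "X \<inter> Y \<subseteq> carrier L" using ideal_carrier[OF X] by blast
    show "x \<sqinter> y \<in> X \<inter> Y"
      using ideal_downward[OF X xy(1)] ideal_downward[OF Y xy(2)] c by (simp add: meet_left meet_right)
  qed (auto intro: ideal_join[OF X] ideal_join[OF Y] ideal_downward[OF X] ideal_downward[OF Y])
qed

lemma ideal_sup_ideal:
  assumes X: "lattice_ideal L X" and Y: "lattice_ideal L Y"
  shows "lattice_ideal L (ideal_sup L X Y)"
proof -
  obtain x y where xy: "x \<in> X" "y \<in> Y" using ideal_nonempty X Y by meson
  note cX = ideal_carrier[OF X] and cY = ideal_carrier[OF Y]
  show ?thesis
  proof (rule lattice_idealI)
    show "ideal_sup L X Y \<subseteq> carrier L" by (auto simp: ideal_sup_def)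
    show "x \<squnion> y \<in> ideal_sup L X Y"
      using cX[OF xy(1)] cY[OF xy(2)] by (intro ideal_supI[OF _ xy]) simp_all
  next
    fix z w assume "z \<in> ideal_sup L X Y" "w \<in> ideal_sup L X Y"
    then obtain x y x' y' where *: "x \<in> X" "y \<in> Y" "x' \<in> X" "y' \<in> Y"
      "z \<in> carrier L" "w \<in> carrier L" "z \<sqsubseteq> x \<squnion> y" "w \<sqsubseteq> x' \<squnion> y'"
      unfolding ideal_sup_def by blast
    note c = cX[OF *(1)] cY[OF *(2)] cX[OF *(3)] cY[OF *(4)]
    have "z \<squnion> w \<sqsubseteq> (x \<squnion> y) \<squnion> (x' \<squnion> y')" using * c by (intro join_mono) auto
    also have "\<dots> = (x \<squnion> x') \<squnion> (y \<squnion> y')"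
      using c by (simp add: join_assoc join_lcomm)
    finally have "z \<squnion> w \<sqsubseteq> (x \<squnion> x') \<squnion> (y \<squnion> y')" using * c by simp
    then show "z \<squnion> w \<in> ideal_sup L X Y"
      using * c by (intro ideal_supI[OF _ ideal_join[OF X] ideal_join[OF Y]]) auto
  next
    fix z w assume z: "z \<in> ideal_sup L X Y" and w: "w \<in> carrier L" "w \<sqsubseteq> z"
    obtain x y where *: "x \<in> X" "y \<in> Y" "z \<in> carrier L" "z \<sqsubseteq> x \<squnion> y"
      using z unfolding ideal_sup_def by blast
    then have "w \<sqsubseteq> x \<squnion> y" using w cX cY by (intro le_trans[OF w(2)]) auto
    then show "w \<in> ideal_sup L X Y" by (rule ideal_supI[OF w(1) *(1,2)])
  qed
qed

lemma ideal_lattice: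
  "lattice (ideal_lattice L)"
  "\<lbrakk>lattice_ideal L X; lattice_ideal L Y\<rbrakk> \<Longrightarrow> X \<squnion>\<^bsub>ideal_lattice L\<^esub> Y = ideal_sup L X Y"
  "\<lbrakk>lattice_ideal L X; lattice_ideal L Y\<rbrakk> \<Longrightarrow> X \<sqinter>\<^bsub>ideal_lattice L\<^esub> Y = X \<inter> Y"
proof -
  have sup: "X \<subseteq> ideal_sup L X Y" "Y \<subseteq> ideal_sup L X Y"
    if X: "lattice_ideal L X" and Y: "lattice_ideal L Y" for X Y
  proof -
    obtain x y where xy: "x \<in> X" "y \<in> Y" using ideal_nonempty X Y by meson
    note c = ideal_carrier[OF X] ideal_carrier[OF Y]
    show "X \<subseteq> ideal_sup L X Y"
      by (rule subsetI, rule ideal_supI[OF _ _ xy(2)]) (use c xy in \<open>auto intro: join_left\<close>)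
    show "Y \<subseteq> ideal_sup L X Y"
      by (rule subsetI, rule ideal_supI[OF _ xy(1)]) (use c xy in \<open>auto intro: join_right\<close>)
  qed
  have least: "ideal_sup L X Y \<subseteq> Z" if "lattice_ideal L Z" "X \<subseteq> Z" "Y \<subseteq> Z" for X Y Z
  proof
    fix z assume "z \<in> ideal_sup L X Y"
    then obtain x y where "x \<in> X" "y \<in> Y" "z \<in> carrier L" "z \<sqsubseteq> x \<squnion> y"
      unfolding ideal_sup_def by blast
    then show "z \<in> Z"
      using that ideal_join[OF that(1), of x y] ideal_downward[OF that(1), of "x \<squnion> y" z] by blast
  qed
  show "lattice (ideal_lattice L)"
  proof (rule latticeI; simp)
    fix X Y assume XY: "lattice_ideal L X" "lattice_ideal L Y"
    show "\<exists>Z. lattice_ideal L Z \<and> X \<subseteq> Z \<and> Y \<subseteq> Z \<and>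
        (\<forall>W. lattice_ideal L W \<longrightarrow> X \<subseteq> W \<longrightarrow> Y \<subseteq> W \<longrightarrow> Z \<subseteq> W)"
      using ideal_sup_ideal[OF XY] sup[OF XY] least by blast
    show "\<exists>Z. lattice_ideal L Z \<and> Z \<subseteq> X \<and> Z \<subseteq> Y \<and>
        (\<forall>W. lattice_ideal L W \<longrightarrow> W \<subseteq> X \<longrightarrow> W \<subseteq> Y \<longrightarrow> W \<subseteq> Z)"
      using ideal_inter[OF XY] by blast
  qed
  then interpret Id: lattice "ideal_lattice L" .
  show "X \<squnion>\<^bsub>ideal_lattice L\<^esub> Y = ideal_sup L X Y" if XY: "lattice_ideal L X" "lattice_ideal L Y"
    by (rule Id.join_eqI) (use XY sup[OF XY] least in \<open>simp_all add: ideal_sup_ideal\<close>)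
  show "X \<sqinter>\<^bsub>ideal_lattice L\<^esub> Y = X \<inter> Y" if XY: "lattice_ideal L X" "lattice_ideal L Y"
    by (rule Id.meet_eqI) (use XY in \<open>simp_all add: ideal_inter\<close>)
qed

end

text \<open>\<open>split\<close> and \<open>common\<close> are the elementwise forms of the two distributive laws for \<open>I\<close> in the ideal
  lattice.  The cancellation property that is also needed for \<open>I\<close> to be a neutral element there comes
  from the modularity of \<open>L\<close>.\<close>

lemma (in modular_lattice) neutral_idealI:
  assumes I: "lattice_ideal L I"
    and split: "\<And>x y z. \<lbrakk>x \<in> carrier L; y \<in> carrier L; z \<in> I; z \<sqsubseteq> x \<squnion> y\<rbrakk>
      \<Longrightarrow> \<exists>x'\<in>I. \<exists>y'\<in>I. x' \<sqsubseteq> x \<and> y' \<sqsubseteq> y \<and> z \<sqsubseteq> x' \<squnion> y'"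
    and common: "\<And>x y z i. \<lbrakk>x \<in> carrier L; y \<in> carrier L; z \<in> carrier L; i \<in> I;
        z \<sqsubseteq> i \<squnion> x; z \<sqsubseteq> i \<squnion> y\<rbrakk>
      \<Longrightarrow> \<exists>i'\<in>I. \<exists>t\<in>carrier L. t \<sqsubseteq> x \<and> t \<sqsubseteq> y \<and> z \<sqsubseteq> i' \<squnion> t"
  shows "neutral_ideal L I"
proof -
  interpret Id: lattice "ideal_lattice L" by (rule ideal_lattice(1))
  note ops = ideal_lattice(2,3)
  note cI = ideal_carrier[OF I]
  have dist: "I \<inter> ideal_sup L X Y = ideal_sup L (I \<inter> X) (I \<inter> Y)"
    if X: "lattice_ideal L X" and Y: "lattice_ideal L Y" for X Y
  proof
    show "I \<inter> ideal_sup L X Y \<subseteq> ideal_sup L (I \<inter> X) (I \<inter> Y)"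
    proof
      fix z assume z: "z \<in> I \<inter> ideal_sup L X Y"
      then obtain x y where *: "x \<in> X" "y \<in> Y" "z \<sqsubseteq> x \<squnion> y" unfolding ideal_sup_def by blast
      then obtain x' y' where "x' \<in> I" "y' \<in> I" "x' \<sqsubseteq> x" "y' \<sqsubseteq> y" "z \<sqsubseteq> x' \<squnion> y'"
        using split[of x y z] z ideal_carrier[OF X] ideal_carrier[OF Y] by blast
      moreover from this have "x' \<in> X" "y' \<in> Y"
        using * ideal_downward[OF X *(1)] ideal_downward[OF Y *(2)] cI by blast+
      ultimately show "z \<in> ideal_sup L (I \<inter> X) (I \<inter> Y)"
        using z cI by (blast intro: ideal_supI)
    qed
    show "ideal_sup L (I \<inter> X) (I \<inter> Y) \<subseteq> I \<inter> ideal_sup L X Y"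
      using ideal_join[OF I] ideal_downward[OF I] unfolding ideal_sup_def by blast
  qed
  have codist: "ideal_sup L I (X \<inter> Y) = ideal_sup L I X \<inter> ideal_sup L I Y"
    if X: "lattice_ideal L X" and Y: "lattice_ideal L Y" for X Y
  proof
    show "ideal_sup L I (X \<inter> Y) \<subseteq> ideal_sup L I X \<inter> ideal_sup L I Y"
      unfolding ideal_sup_def by blast
    show "ideal_sup L I X \<inter> ideal_sup L I Y \<subseteq> ideal_sup L I (X \<inter> Y)"
    proof
      fix z assume "z \<in> ideal_sup L I X \<inter> ideal_sup L I Y"
      then obtain i x j y where *: "z \<in> carrier L" "i \<in> I" "j \<in> I" "x \<in> X" "y \<in> Y"
        "z \<sqsubseteq> i \<squnion> x" "z \<sqsubseteq> j \<squnion> y" unfolding ideal_sup_def by blast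
      note c = cI[OF *(2)] cI[OF *(3)] ideal_carrier[OF X *(4)] ideal_carrier[OF Y *(5)]
      have "i \<squnion> x \<sqsubseteq> (i \<squnion> j) \<squnion> x" "j \<squnion> y \<sqsubseteq> (i \<squnion> j) \<squnion> y"
        using c by (intro join_mono join_left join_right; simp)+
      then have "z \<sqsubseteq> (i \<squnion> j) \<squnion> x" "z \<sqsubseteq> (i \<squnion> j) \<squnion> y"
        using le_trans[OF *(6)] le_trans[OF *(7)] * c by simp_all
      then obtain k t where "k \<in> I" "t \<in> carrier L" "t \<sqsubseteq> x" "t \<sqsubseteq> y" "z \<sqsubseteq> k \<squnion> t"
        using common[of x y z "i \<squnion> j"] * c ideal_join[OF I *(2,3)] by blast
      moreover from this have "t \<in> X" "t \<in> Y"
        using ideal_downward[OF X *(4)] ideal_downward[OF Y *(5)] by blast+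
      ultimately show "z \<in> ideal_sup L I (X \<inter> Y)" using * unfolding ideal_sup_def by blast
    qed
  qed
  have cancel: "X = Y"
    if X: "lattice_ideal L X" and Y: "lattice_ideal L Y" and "X \<subseteq> Y"
      and meet: "I \<inter> X = I \<inter> Y" and join: "ideal_sup L I X = ideal_sup L I Y" for X Y
  proof
    show "X \<subseteq> Y" by fact
    show "Y \<subseteq> X"
    proof
      fix y assume y: "y \<in> Y"
      note cy = ideal_carrier[OF Y y]
      obtain i0 where i0: "i0 \<in> I" using ideal_nonempty[OF I] by blast
      have "y \<in> ideal_sup L I X" unfolding join
        using cy cI[OF i0] by (intro ideal_supI[OF _ i0 y] join_right) auto
      then obtain i x where ix: "i \<in> I" "x \<in> X" "y \<sqsubseteq> i \<squnion> x"
        unfolding ideal_sup_def by blast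
      note c = cy cI[OF ix(1)] ideal_carrier[OF X ix(2)]
      \<comment> \<open>Replacing \<open>y\<close> by \<open>y \<squnion> x\<close> gives an element between \<open>x\<close> and \<open>x \<squnion> i\<close>, to which modularity applies.\<close>
      have "y \<squnion> x \<in> Y" using ideal_join[OF Y y] ix(2) \<open>X \<subseteq> Y\<close> by blast
      then have "i \<sqinter> (y \<squnion> x) \<in> I \<inter> Y"
        using ideal_downward[OF I ix(1)] ideal_downward[OF Y] c by (simp add: meet_left meet_right)
      then have "x \<squnion> (i \<sqinter> (y \<squnion> x)) \<in> X" using ideal_join[OF X ix(2)] meet by blast
      moreover have "x \<squnion> (i \<sqinter> (y \<squnion> x)) = (x \<squnion> i) \<sqinter> (y \<squnion> x)"
        using modular[of x i "y \<squnion> x"] c by (simp add: join_right)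
      moreover have "y \<sqsubseteq> (x \<squnion> i) \<sqinter> (y \<squnion> x)"
        using c ix(3) join_comm[of L i x] by (intro meet_le join_left) auto
      ultimately show "y \<in> X" using ideal_downward[OF X _ cy] by metis
    qed
  qed
  show ?thesis unfolding neutral_ideal_def
  proof (intro conjI allI impI I)
    fix X Y assume XY: "lattice_ideal L X" "lattice_ideal L Y"
    show "distributive_sublattice (ideal_lattice L) (generated_sublattice (ideal_lattice L) {I, X, Y})"
      by (rule Id.neutral_element_generates_distributive)
        (use XY I cancel in \<open>simp_all add: ops ideal_inter ideal_sup_ideal dist codist\<close>)
  qed
qed

section \<open>Reduced powers modulo the Frechet filter\<close>

definition germ :: "(nat \<Rightarrow> 'a) \<Rightarrow> (nat \<Rightarrow> 'a) set" where
  "germ f = {g. eventually (\<lambda>n. g n = f n) sequentially}"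

text \<open>When \<open>S\<close> consists of all sequences in \<open>L\<close>, this is the full reduced power modulo the Frechet filter;
  a smaller \<open>S\<close> gives a suborder of it.\<close>

definition reduced_power ::
    "('a, 'b) gorder_scheme \<Rightarrow> (nat \<Rightarrow> 'a) set \<Rightarrow> (nat \<Rightarrow> 'a) set gorder" where
  "reduced_power L S = \<lparr>carrier = germ ` S, eq = (=),
     le = (\<lambda>A B. \<exists>f\<in>A. \<exists>g\<in>B. eventually (\<lambda>n. f n \<sqsubseteq>\<^bsub>L\<^esub> g n) sequentially)\<rparr>"

lemma germ_eq_iff: "germ f = germ g \<longleftrightarrow> eventually (\<lambda>n. f n = g n) sequentially"
proof
  assume "germ f = germ g"
  moreover have "f \<in> germ f" by (simp add: germ_def)
  ultimately show "eventually (\<lambda>n. f n = g n) sequentially" by (simp add: germ_def)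
next
  assume "eventually (\<lambda>n. f n = g n) sequentially"
  then show "germ f = germ g" unfolding germ_def
    by (auto elim: eventually_elim2)
qed

lemma reduced_power_simps [simp]:
  "carrier (reduced_power L S) = germ ` S"
  "eq (reduced_power L S) = (=)"
  "(germ f \<sqsubseteq>\<^bsub>reduced_power L S\<^esub> germ g) \<longleftrightarrow> eventually (\<lambda>n. f n \<sqsubseteq>\<^bsub>L\<^esub> g n) sequentially"
proof -
  have "eventually (\<lambda>n. f n \<sqsubseteq>\<^bsub>L\<^esub> g n) sequentially"
    if "f' \<in> germ f" "g' \<in> germ g" "eventually (\<lambda>n. f' n \<sqsubseteq>\<^bsub>L\<^esub> g' n) sequentially" for f' g'
    using that unfolding germ_def mem_Collect_eq by eventually_elim simp
  moreover have "f \<in> germ f" "g \<in> germ g" by (simp_all add: germ_def)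
  ultimately show "(germ f \<sqsubseteq>\<^bsub>reduced_power L S\<^esub> germ g) \<longleftrightarrow>
      eventually (\<lambda>n. f n \<sqsubseteq>\<^bsub>L\<^esub> g n) sequentially"
    unfolding reduced_power_def by auto
qed (simp_all add: reduced_power_def)

text \<open>Closure is required of germs only: \<open>S\<close> may miss the pointwise join of two of its members, as
  long as it contains a sequence that is eventually equal to it.\<close>

locale reduced_power_carrier = lattice L for L :: "('a, 'b) gorder_scheme" (structure) +
  fixes S :: "(nat \<Rightarrow> 'a) set"
  assumes S_closed: "f \<in> S \<Longrightarrow> f n \<in> carrier L"
    and S_join: "\<lbrakk>f \<in> S; g \<in> S\<rbrakk> \<Longrightarrow> germ (\<lambda>n. f n \<squnion> g n) \<in> germ ` S"
    and S_meet: "\<lbrakk>f \<in> S; g \<in> S\<rbrakk> \<Longrightarrow> germ (\<lambda>n. f n \<sqinter> g n) \<in> germ ` S"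
begin

lemma germ_join_least:
  assumes fg: "f \<in> S" "g \<in> S" and D: "D \<in> carrier (reduced_power L S)"
    "germ f \<sqsubseteq>\<^bsub>reduced_power L S\<^esub> D" "germ g \<sqsubseteq>\<^bsub>reduced_power L S\<^esub> D"
  shows "germ (\<lambda>n. f n \<squnion> g n) \<sqsubseteq>\<^bsub>reduced_power L S\<^esub> D"
proof -
  obtain h where h: "h \<in> S" "D = germ h" using D by auto
  have "eventually (\<lambda>n. f n \<sqsubseteq> h n) sequentially" "eventually (\<lambda>n. g n \<sqsubseteq> h n) sequentially"
    using D h by simp_all
  then have "eventually (\<lambda>n. f n \<squnion> g n \<sqsubseteq> h n) sequentially"
    by eventually_elim (simp add: join_le S_closed fg h)
  then show ?thesis using h by simp
qed

lemma germ_meet_greatest: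
  assumes fg: "f \<in> S" "g \<in> S" and D: "D \<in> carrier (reduced_power L S)"
    "D \<sqsubseteq>\<^bsub>reduced_power L S\<^esub> germ f" "D \<sqsubseteq>\<^bsub>reduced_power L S\<^esub> germ g"
  shows "D \<sqsubseteq>\<^bsub>reduced_power L S\<^esub> germ (\<lambda>n. f n \<sqinter> g n)"
proof -
  obtain h where h: "h \<in> S" "D = germ h" using D by auto
  have "eventually (\<lambda>n. h n \<sqsubseteq> f n) sequentially" "eventually (\<lambda>n. h n \<sqsubseteq> g n) sequentially"
    using D h by simp_all
  then have "eventually (\<lambda>n. h n \<sqsubseteq> f n \<sqinter> g n) sequentially"
    by eventually_elim (simp add: meet_le S_closed fg h)
  then show ?thesis using h by simp
qed

lemma reduced_power_lattice: "lattice (reduced_power L S)"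
proof (rule latticeI)
  let ?M = "reduced_power L S"
  show "eq ?M = (=)" by simp
  show "A \<sqsubseteq>\<^bsub>?M\<^esub> A" if "A \<in> carrier ?M" for A using that S_closed by auto
  show "A = B" if AB: "A \<in> carrier ?M" "B \<in> carrier ?M" "A \<sqsubseteq>\<^bsub>?M\<^esub> B" "B \<sqsubseteq>\<^bsub>?M\<^esub> A" for A B
  proof -
    obtain f g where fg: "f \<in> S" "g \<in> S" "A = germ f" "B = germ g" using AB by auto
    have "eventually (\<lambda>n. f n \<sqsubseteq> g n) sequentially" "eventually (\<lambda>n. g n \<sqsubseteq> f n) sequentially"
      using AB fg by simp_all
    then have "eventually (\<lambda>n. f n = g n) sequentially"
      by eventually_elim (auto intro: S_closed fg)
    then show ?thesis using fg by (simp add: germ_eq_iff)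
  qed
  show "A \<sqsubseteq>\<^bsub>?M\<^esub> C" if ABC: "A \<in> carrier ?M" "B \<in> carrier ?M" "C \<in> carrier ?M"
    "A \<sqsubseteq>\<^bsub>?M\<^esub> B" "B \<sqsubseteq>\<^bsub>?M\<^esub> C" for A B C
  proof -
    obtain f g h where fgh: "f \<in> S" "g \<in> S" "h \<in> S" "A = germ f" "B = germ g" "C = germ h"
      using ABC by auto
    have "eventually (\<lambda>n. f n \<sqsubseteq> g n) sequentially" "eventually (\<lambda>n. g n \<sqsubseteq> h n) sequentially"
      using ABC fgh by simp_all
    then have "eventually (\<lambda>n. f n \<sqsubseteq> h n) sequentially"
      by eventually_elim (auto intro: le_trans S_closed fgh)
    then show ?thesis using fgh by simp
  qed
  fix A B assume "A \<in> carrier ?M" "B \<in> carrier ?M"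
  then obtain f g where fg: "f \<in> S" "g \<in> S" "A = germ f" "B = germ g" by auto
  note c = S_closed[OF fg(1)] S_closed[OF fg(2)]
  show "\<exists>C\<in>carrier ?M. A \<sqsubseteq>\<^bsub>?M\<^esub> C \<and> B \<sqsubseteq>\<^bsub>?M\<^esub> C \<and>
      (\<forall>D\<in>carrier ?M. A \<sqsubseteq>\<^bsub>?M\<^esub> D \<longrightarrow> B \<sqsubseteq>\<^bsub>?M\<^esub> D \<longrightarrow> C \<sqsubseteq>\<^bsub>?M\<^esub> D)"
  proof (intro bexI[of _ "germ (\<lambda>n. f n \<squnion> g n)"] conjI ballI impI)
    fix D assume D: "D \<in> carrier ?M" "A \<sqsubseteq>\<^bsub>?M\<^esub> D" "B \<sqsubseteq>\<^bsub>?M\<^esub> D"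
    then show "germ (\<lambda>n. f n \<squnion> g n) \<sqsubseteq>\<^bsub>?M\<^esub> D" using germ_join_least[OF fg(1,2) D(1)] fg by simp
  qed (use fg c S_join in \<open>simp_all add: join_left join_right\<close>)
  show "\<exists>C\<in>carrier ?M. C \<sqsubseteq>\<^bsub>?M\<^esub> A \<and> C \<sqsubseteq>\<^bsub>?M\<^esub> B \<and>
      (\<forall>D\<in>carrier ?M. D \<sqsubseteq>\<^bsub>?M\<^esub> A \<longrightarrow> D \<sqsubseteq>\<^bsub>?M\<^esub> B \<longrightarrow> D \<sqsubseteq>\<^bsub>?M\<^esub> C)"
  proof (intro bexI[of _ "germ (\<lambda>n. f n \<sqinter> g n)"] conjI ballI impI)
    fix D assume D: "D \<in> carrier ?M" "D \<sqsubseteq>\<^bsub>?M\<^esub> A" "D \<sqsubseteq>\<^bsub>?M\<^esub> B"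
    then show "D \<sqsubseteq>\<^bsub>?M\<^esub> germ (\<lambda>n. f n \<sqinter> g n)" using germ_meet_greatest[OF fg(1,2) D(1)] fg by simp
  qed (use fg c S_meet in \<open>simp_all add: meet_left meet_right\<close>)
qed

sublocale RP: lattice "reduced_power L S"
  by (rule reduced_power_lattice)

lemma germ_join:
  assumes "germ f \<in> germ ` S" "germ g \<in> germ ` S"
  shows "germ f \<squnion>\<^bsub>reduced_power L S\<^esub> germ g = germ (\<lambda>n. f n \<squnion> g n)"
proof -
  obtain f' g' where fg: "f' \<in> S" "g' \<in> S" "germ f = germ f'" "germ g = germ g'"
    using assms by auto
  note c = S_closed[OF fg(1)] S_closed[OF fg(2)]
  have "germ f' \<squnion>\<^bsub>reduced_power L S\<^esub> germ g' = germ (\<lambda>n. f' n \<squnion> g' n)"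
    by (rule RP.join_eqI)
      (use fg c S_join germ_join_least in \<open>simp_all add: join_left join_right\<close>)
  moreover have "germ (\<lambda>n. f' n \<squnion> g' n) = germ (\<lambda>n. f n \<squnion> g n)"
    using fg(3,4) unfolding germ_eq_iff by eventually_elim simp
  ultimately show ?thesis using fg by simp
qed

lemma germ_meet:
  assumes "germ f \<in> germ ` S" "germ g \<in> germ ` S"
  shows "germ f \<sqinter>\<^bsub>reduced_power L S\<^esub> germ g = germ (\<lambda>n. f n \<sqinter> g n)"
proof -
  obtain f' g' where fg: "f' \<in> S" "g' \<in> S" "germ f = germ f'" "germ g = germ g'"
    using assms by auto
  note c = S_closed[OF fg(1)] S_closed[OF fg(2)]
  have "germ f' \<sqinter>\<^bsub>reduced_power L S\<^esub> germ g' = germ (\<lambda>n. f' n \<sqinter> g' n)"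
    by (rule RP.meet_eqI)
      (use fg c S_meet germ_meet_greatest in \<open>simp_all add: meet_left meet_right\<close>)
  moreover have "germ (\<lambda>n. f' n \<sqinter> g' n) = germ (\<lambda>n. f n \<sqinter> g n)"
    using fg(3,4) unfolding germ_eq_iff by eventually_elim simp
  ultimately show ?thesis using fg by simp
qed

lemma germ_lterm_val:
  assumes "\<And>i. w i \<in> S"
  shows "lterm_val (reduced_power L S) (\<lambda>i. germ (w i)) t = germ (\<lambda>n. lterm_val L (\<lambda>i. w i n) t) \<and>
    germ (\<lambda>n. lterm_val L (\<lambda>i. w i n) t) \<in> germ ` S"
proof (induction t)
  case (Var i)
  then show ?case using assms by simp
next
  case (Join s t)
  then show ?case
    using germ_join[of "\<lambda>n. lterm_val L (\<lambda>i. w i n) s" "\<lambda>n. lterm_val L (\<lambda>i. w i n) t"]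
      RP.join_closed[of "germ (\<lambda>n. lterm_val L (\<lambda>i. w i n) s)" "germ (\<lambda>n. lterm_val L (\<lambda>i. w i n) t)"]
    by simp
next
  case (Meet s t)
  then show ?case
    using germ_meet[of "\<lambda>n. lterm_val L (\<lambda>i. w i n) s" "\<lambda>n. lterm_val L (\<lambda>i. w i n) t"]
      RP.meet_closed[of "germ (\<lambda>n. lterm_val L (\<lambda>i. w i n) s)" "germ (\<lambda>n. lterm_val L (\<lambda>i. w i n) t)"]
    by simp
qed

text \<open>An equation holds between germs iff it holds at almost all indices.  A quasi-identity has finitely
  many premises, so they hold simultaneously at almost all indices, and there the conclusion follows in \<open>L\<close>.\<close>

lemma reduced_power_satisfies:
  assumes "satisfies L q"
  shows "satisfies (reduced_power L S) q"
proof (cases q)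
  case (Quasi_Identity ps c)
  have "eqn_holds (reduced_power L S) v c"
    if v: "range v \<subseteq> carrier (reduced_power L S)"
      and ps: "\<forall>p\<in>set ps. eqn_holds (reduced_power L S) v p" for v
  proof -
    have "\<forall>i. \<exists>f. f \<in> S \<and> v i = germ f" using v by auto
    then obtain w where w: "\<And>i. w i \<in> S" "\<And>i. v i = germ (w i)" by metis
    then have v_eq: "v = (\<lambda>i. germ (w i))" by auto
    have holds: "eqn_holds (reduced_power L S) v e \<longleftrightarrow>
        eventually (\<lambda>n. eqn_holds L (\<lambda>i. w i n) e) sequentially" for e
      using germ_lterm_val[OF w(1)] unfolding v_eq eqn_holds_def by (simp add: germ_eq_iff)
    have "eventually (\<lambda>n. \<forall>p\<in>set ps. eqn_holds L (\<lambda>i. w i n) p) sequentially"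
      using ps holds by (intro eventually_ball_finite) auto
    then have "eventually (\<lambda>n. eqn_holds L (\<lambda>i. w i n) c) sequentially"
    proof eventually_elim
      case (elim n)
      moreover have "range (\<lambda>i. w i n) \<subseteq> carrier L" using S_closed[OF w(1)] by auto
      ultimately show ?case using assms unfolding Quasi_Identity satisfies.simps by blast
    qed
    then show ?thesis using holds by simp
  qed
  then show ?thesis unfolding Quasi_Identity by simp
qed

lemma reduced_power_in_quasivariety:
  "in_quasivariety L Q \<Longrightarrow> in_quasivariety (reduced_power L S) Q"
  using reduced_power_lattice reduced_power_satisfies by (simp add: in_quasivariety_def)

lemma reduced_power_modular:
  assumes "modular_lattice L"
  shows "modular_lattice (reduced_power L S)"
proof (intro modular_lattice.intro reduced_power_lattice modular_lattice_axioms.intro)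
  let ?M = "reduced_power L S"
  fix A B C assume ABC: "A \<in> carrier ?M" "B \<in> carrier ?M" "C \<in> carrier ?M" "A \<sqsubseteq>\<^bsub>?M\<^esub> C"
  then obtain f g h where fgh: "f \<in> S" "g \<in> S" "h \<in> S" "A = germ f" "B = germ g" "C = germ h"
    by auto
  have "eventually (\<lambda>n. f n \<sqsubseteq> h n) sequentially" using ABC fgh by simp
  then have "eventually (\<lambda>n. f n \<squnion> (g n \<sqinter> h n) = (f n \<squnion> g n) \<sqinter> h n) sequentially"
    by eventually_elim (intro modular_lattice.modular[OF assms] S_closed fgh)
  then show "A \<squnion>\<^bsub>?M\<^esub> (B \<sqinter>\<^bsub>?M\<^esub> C) = (A \<squnion>\<^bsub>?M\<^esub> B) \<sqinter>\<^bsub>?M\<^esub> C"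
    using fgh(4-6) imageI[OF fgh(1), of germ] imageI[OF fgh(2), of germ]
      imageI[OF fgh(3), of germ] S_join[OF fgh(1,2)] S_meet[OF fgh(2,3)]
    by (simp add: germ_join germ_meet germ_eq_iff[symmetric])
qed

end

section \<open>The complemented modular extension\<close>

locale nat_trace = bounded_below_modular_lattice L for L :: "('a, 'b) gorder_scheme" (structure) +
  fixes a :: "nat \<Rightarrow> nat \<Rightarrow> 'a"
  assumes trace: "banaschewski_trace L nat_order a"
begin

text \<open>The Boolean records whether an element is cofinite.  Below the stage \<open>m\<close> the family \<open>a\<close> need not
  take values in \<open>L\<close>, so the argument is cut off there; this does not affect the germ.\<close>

definition tail :: "bool \<Rightarrow> nat \<Rightarrow> nat \<Rightarrow> 'a" where
  "tail \<epsilon> m n = (if \<epsilon> then a m (max m n) else \<bottom>)"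

definition sequences :: "(nat \<Rightarrow> 'a) set" where
  "sequences = {(\<lambda>n. x \<squnion> tail \<epsilon> m n) |\<epsilon> m x. x \<in> carrier L \<and> x \<sqsubseteq> a 0 m}"

abbreviation Ext :: "(nat \<Rightarrow> 'a) set gorder" where
  "Ext \<equiv> reduced_power L sequences"

definition elt :: "bool \<Rightarrow> nat \<Rightarrow> 'a \<Rightarrow> (nat \<Rightarrow> 'a) set" where
  "elt \<epsilon> k x = germ (\<lambda>n. x \<squnion> tail \<epsilon> k n)"

definition embed :: "'a \<Rightarrow> (nat \<Rightarrow> 'a) set" where
  "embed x = germ (\<lambda>_. x)"

lemma trace_closed: "i \<le> j \<Longrightarrow> a i j \<in> carrier L"
  and trace_osum: "\<lbrakk>i \<le> j; j \<le> k\<rbrakk> \<Longrightarrow> osum L (a i j) (a j k) (a i k)"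
  and trace_cofinal: "x \<in> carrier L \<Longrightarrow> \<exists>n. x \<sqsubseteq> a 0 n"
  using trace unfolding banaschewski_trace_nat_order by auto

lemma a0_closed [simp]: "a 0 n \<in> carrier L"
  by (simp add: trace_closed)

lemma tail_closed [simp]: "tail \<epsilon> m n \<in> carrier L"
  by (simp add: tail_def trace_closed)

lemma tail_join: "\<lbrakk>m \<le> k; k \<le> n\<rbrakk> \<Longrightarrow> tail \<epsilon> m k \<squnion> tail \<epsilon> k n = tail \<epsilon> m n"
  using trace_osum[of m k n] by (simp add: tail_def osum_def)

lemma a0_mono: "m \<le> n \<Longrightarrow> a 0 m \<sqsubseteq> a 0 n"
  using trace_osum[of 0 m n] join_left[of "a 0 m" "a m n"] by (simp add: osum_def trace_closed)

lemma tail_le: "m \<le> n \<Longrightarrow> tail \<epsilon> m n \<sqsubseteq> a 0 n"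
  using trace_osum[of 0 m n] join_right[of "a 0 m" "a m n"]
  by (simp add: osum_def trace_closed tail_def)

lemma le_a0_mono: "\<lbrakk>x \<sqsubseteq> a 0 m; m \<le> n; x \<in> carrier L\<rbrakk> \<Longrightarrow> x \<sqsubseteq> a 0 n"
  using le_trans[OF _ a0_mono] by simp

text \<open>The elements of \<open>Ext\<close> have many representations.  A representation at stage \<open>m\<close> gives one at each later
  stage, because \<open>a m n = a m k \<squnion> a k n\<close>.\<close>

lemma elt_shift:
  assumes "x \<in> carrier L" "m \<le> k"
  shows "elt \<epsilon> m x = elt \<epsilon> k (x \<squnion> tail \<epsilon> m k)"
  unfolding elt_def germ_eq_iff using eventually_ge_at_top[of k]
  by eventually_elim (simp add: assms tail_join join_assoc)

definition at_stage :: "nat \<Rightarrow> (nat \<Rightarrow> 'a) set \<Rightarrow> bool" where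
  "at_stage k A \<longleftrightarrow> (\<exists>\<epsilon> x. x \<in> carrier L \<and> x \<sqsubseteq> a 0 k \<and> A = elt \<epsilon> k x)"

lemma common_stage:
  assumes "finite F" "F \<subseteq> germ ` sequences" "finite E" "E \<subseteq> carrier L"
  shows "\<exists>k. (\<forall>A\<in>F. at_stage k A) \<and> (\<forall>z\<in>E. z \<sqsubseteq> a 0 k)"
proof -
  have stage: "eventually (\<lambda>k. at_stage k A) sequentially" if "A \<in> germ ` sequences" for A
  proof -
    obtain \<epsilon> m x where A: "x \<in> carrier L" "x \<sqsubseteq> a 0 m" "A = elt \<epsilon> m x"
      using \<open>A \<in> germ ` sequences\<close> unfolding sequences_def elt_def by blast
    have "at_stage k A" if "m \<le> k" for k unfolding at_stage_def
    proof (intro exI conjI)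
      show "x \<squnion> tail \<epsilon> m k \<sqsubseteq> a 0 k"
        using A that by (intro join_le tail_le le_a0_mono[of x m k]) auto
      show "A = elt \<epsilon> k (x \<squnion> tail \<epsilon> m k)" using elt_shift A that by simp
    qed (use A in auto)
    then show ?thesis by (auto simp: eventually_sequentially)
  qed
  have below: "eventually (\<lambda>k. z \<sqsubseteq> a 0 k) sequentially" if z: "z \<in> carrier L" for z
    using trace_cofinal[OF z] le_a0_mono[OF _ _ z] unfolding eventually_sequentially by blast
  have "\<forall>A\<in>F. eventually (\<lambda>k. at_stage k A) sequentially"
    "\<forall>z\<in>E. eventually (\<lambda>k. z \<sqsubseteq> a 0 k) sequentially"
    by (intro ballI stage below subsetD[OF assms(2)] subsetD[OF assms(4)], assumption)+
  from eventually_conj[OF eventually_ball_finite[OF assms(1) this(1)]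
      eventually_ball_finite[OF assms(3) this(2)]]
  show ?thesis by (rule eventually_happens'[OF sequentially_bot])
qed

text \<open>At a fixed stage, the pointwise operations act separately on the part below \<open>a 0 k\<close> and on
  the tail: for joins this is associativity, for meets it is the independence of \<open>a 0 k\<close> and
  \<open>a k n\<close>.\<close>

lemma elt_ops:
  assumes xy: "x \<in> carrier L" "y \<in> carrier L" "x \<sqsubseteq> a 0 k" "y \<sqsubseteq> a 0 k"
  shows "germ (\<lambda>n. (x \<squnion> tail \<epsilon> k n) \<squnion> (y \<squnion> tail \<delta> k n)) = elt (\<epsilon> \<or> \<delta>) k (x \<squnion> y)"
    and "germ (\<lambda>n. (x \<squnion> tail \<epsilon> k n) \<sqinter> (y \<squnion> tail \<delta> k n)) = elt (\<epsilon> \<and> \<delta>) k (x \<sqinter> y)"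
proof -
  have "tail \<epsilon> k n \<squnion> tail \<delta> k n = tail (\<epsilon> \<or> \<delta>) k n" for n
    using join_absorb(1)[of "a k (max k n)" "a k (max k n)"] by (simp add: tail_def trace_closed)
  then have "(x \<squnion> tail \<epsilon> k n) \<squnion> (y \<squnion> tail \<delta> k n) = (x \<squnion> y) \<squnion> tail (\<epsilon> \<or> \<delta>) k n" for n
    using xy by (simp add: join_assoc join_lcomm[of "tail \<epsilon> k n" y])
  then show "germ (\<lambda>n. (x \<squnion> tail \<epsilon> k n) \<squnion> (y \<squnion> tail \<delta> k n)) = elt (\<epsilon> \<or> \<delta>) k (x \<squnion> y)"
    by (simp add: elt_def)
  have "(x \<squnion> tail \<epsilon> k n) \<sqinter> (y \<squnion> tail \<delta> k n) = (x \<sqinter> y) \<squnion> tail (\<epsilon> \<and> \<delta>) k n" if "k \<le> n" for n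
  proof -
    have "tail \<epsilon> k n \<sqinter> tail \<delta> k n = tail (\<epsilon> \<and> \<delta>) k n"
      using meet_absorb(1)[of "a k (max k n)" "a k (max k n)"] by (simp add: tail_def trace_closed)
    moreover have "a 0 k \<sqinter> a k n = \<bottom>" using trace_osum[of 0 k n] that by (simp add: osum_def)
    moreover have "tail \<gamma> k n \<sqsubseteq> a k n" for \<gamma> using that by (simp add: tail_def trace_closed max_def)
    ultimately show ?thesis
      using independent_meet_join[of "a 0 k" "a k n" x y "tail \<epsilon> k n" "tail \<delta> k n"] xy that
      by (simp add: trace_closed)
  qed
  then show "germ (\<lambda>n. (x \<squnion> tail \<epsilon> k n) \<sqinter> (y \<squnion> tail \<delta> k n)) = elt (\<epsilon> \<and> \<delta>) k (x \<sqinter> y)"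
    unfolding elt_def germ_eq_iff by (auto simp: eventually_sequentially)
qed

lemma elt_closed: "\<lbrakk>x \<in> carrier L; x \<sqsubseteq> a 0 k\<rbrakk> \<Longrightarrow> elt \<epsilon> k x \<in> germ ` sequences"
  unfolding elt_def sequences_def by blast

sublocale reduced_power_carrier L sequences
proof
  show "f n \<in> carrier L" if "f \<in> sequences" for f n using that by (auto simp: sequences_def)
next
  fix f g assume fg: "f \<in> sequences" "g \<in> sequences"
  then obtain k where "at_stage k (germ f)" "at_stage k (germ g)"
    using common_stage[of "{germ f, germ g}" "{}"] by auto
  then obtain \<epsilon> x \<delta> y where *: "x \<in> carrier L" "x \<sqsubseteq> a 0 k" "germ f = elt \<epsilon> k x"
    "y \<in> carrier L" "y \<sqsubseteq> a 0 k" "germ g = elt \<delta> k y" unfolding at_stage_def by blast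
  have eq: "eventually (\<lambda>n. f n = x \<squnion> tail \<epsilon> k n) sequentially"
    "eventually (\<lambda>n. g n = y \<squnion> tail \<delta> k n) sequentially"
    using *(3,6) unfolding elt_def germ_eq_iff by auto
  have "germ (\<lambda>n. f n \<squnion> g n) = germ (\<lambda>n. (x \<squnion> tail \<epsilon> k n) \<squnion> (y \<squnion> tail \<delta> k n))"
    unfolding germ_eq_iff using eq by eventually_elim simp
  then show "germ (\<lambda>n. f n \<squnion> g n) \<in> germ ` sequences"
    using elt_closed * by (simp add: elt_ops join_le)
  have "germ (\<lambda>n. f n \<sqinter> g n) = germ (\<lambda>n. (x \<squnion> tail \<epsilon> k n) \<sqinter> (y \<squnion> tail \<delta> k n))"
    unfolding germ_eq_iff using eq by eventually_elim simp
  then show "germ (\<lambda>n. f n \<sqinter> g n) \<in> germ ` sequences"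
    using elt_closed * by (simp add: elt_ops meet_leI1)
qed

lemma elt_join:
  assumes "x \<in> carrier L" "y \<in> carrier L" "x \<sqsubseteq> a 0 k" "y \<sqsubseteq> a 0 k"
  shows "elt \<epsilon> k x \<squnion>\<^bsub>Ext\<^esub> elt \<delta> k y = elt (\<epsilon> \<or> \<delta>) k (x \<squnion> y)"
  using assms germ_join[OF elt_closed[unfolded elt_def] elt_closed[unfolded elt_def]] elt_ops(1)
  unfolding elt_def by simp

lemma elt_meet:
  assumes "x \<in> carrier L" "y \<in> carrier L" "x \<sqsubseteq> a 0 k" "y \<sqsubseteq> a 0 k"
  shows "elt \<epsilon> k x \<sqinter>\<^bsub>Ext\<^esub> elt \<delta> k y = elt (\<epsilon> \<and> \<delta>) k (x \<sqinter> y)"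
  using assms germ_meet[OF elt_closed[unfolded elt_def] elt_closed[unfolded elt_def]] elt_ops(2)
  unfolding elt_def by simp

lemma elt_mono:
  assumes "x \<in> carrier L" "y \<in> carrier L" "x \<sqsubseteq> y" "\<epsilon> \<longrightarrow> \<delta>"
  shows "elt \<epsilon> k x \<sqsubseteq>\<^bsub>Ext\<^esub> elt \<delta> k y"
proof -
  have "tail \<epsilon> k n \<sqsubseteq> tail \<delta> k n" for n using assms(4) by (auto simp: tail_def trace_closed)
  then show ?thesis using assms unfolding elt_def by (simp add: join_mono)
qed

lemma embed_eq_elt: "x \<in> carrier L \<Longrightarrow> embed x = elt False k x"
  by (simp add: embed_def elt_def tail_def)

lemma embed_closed: "x \<in> carrier L \<Longrightarrow> embed x \<in> germ ` sequences"
  using trace_cofinal embed_eq_elt elt_closed by metis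

lemma embed_eq_iff: "embed x = embed y \<longleftrightarrow> x = y"
  by (simp add: embed_def germ_eq_iff)

lemma embed_join: "\<lbrakk>x \<in> carrier L; y \<in> carrier L\<rbrakk> \<Longrightarrow> embed (x \<squnion> y) = embed x \<squnion>\<^bsub>Ext\<^esub> embed y"
  using germ_join[OF embed_closed[unfolded embed_def] embed_closed[unfolded embed_def], of x y]
  by (simp add: embed_def)

lemma embed_meet: "\<lbrakk>x \<in> carrier L; y \<in> carrier L\<rbrakk> \<Longrightarrow> embed (x \<sqinter> y) = embed x \<sqinter>\<^bsub>Ext\<^esub> embed y"
  using germ_meet[OF embed_closed[unfolded embed_def] embed_closed[unfolded embed_def], of x y]
  by (simp add: embed_def)

lemma embed_lattice_embedding: "lattice_embedding L Ext embed"
  unfolding lattice_embedding_def join_pres_def meet_pres_def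
  using embed_closed embed_join embed_meet reduced_power_lattice lattice_axioms
  by (auto simp: inj_on_def embed_eq_iff)

lemma embed_bottom_least: "A \<in> germ ` sequences \<Longrightarrow> embed \<bottom> \<sqsubseteq>\<^bsub>Ext\<^esub> A"
  using S_closed by (auto simp: embed_def)

text \<open>For every \<open>k\<close> this is the germ of \<open>n \<mapsto> a 0 n\<close>, which is the unit; having it at
  every stage lets complements be computed at the stage of the given element.\<close>

lemma elt_le_top: "A \<in> germ ` sequences \<Longrightarrow> A \<sqsubseteq>\<^bsub>Ext\<^esub> elt True k (a 0 k)"
proof -
  assume "A \<in> germ ` sequences"
  then obtain m where "at_stage m A" using common_stage[of "{A}" "{}"] by auto
  then obtain \<epsilon> x where *: "x \<in> carrier L" "x \<sqsubseteq> a 0 m" "A = elt \<epsilon> m x"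
    unfolding at_stage_def by blast
  have "x \<squnion> tail \<epsilon> m n \<sqsubseteq> a 0 k \<squnion> tail True k n" if "max k m \<le> n" for n
  proof -
    have "a 0 k \<squnion> tail True k n = a 0 n"
      using trace_osum[of 0 k n] that by (simp add: osum_def tail_def)
    then show ?thesis using * that by (simp add: join_le tail_le le_a0_mono[of x m n])
  qed
  then show ?thesis
    unfolding *(3) elt_def reduced_power_simps(3) eventually_sequentially by blast
qed

lemma Ext_bounded: "bounded_lattice Ext"
proof (intro bounded_lattice.intro reduced_power_lattice weak_partial_order_bottom.intro
    weak_partial_order_top.intro weak_partial_order_bottom_axioms.intro
    weak_partial_order_top_axioms.intro RP.weak_partial_order_axioms)
  show "\<exists>A. least Ext A (carrier Ext)"
    using embed_bottom_least embed_closed[OF bottom_closed]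
    by (intro exI[of _ "embed \<bottom>"]) (simp add: least_def subset_iff)
  show "\<exists>A. greatest Ext A (carrier Ext)"
    using elt_le_top[of _ 0] elt_closed[of "a 0 0" 0 True]
    by (intro exI[of _ "elt True 0 (a 0 0)"]) (simp add: greatest_def subset_iff)
qed

lemma Ext_complemented:
  assumes "sectionally_complemented_lattice L"
  shows "complemented_lattice Ext"
proof (intro complemented_lattice.intro Ext_bounded complemented_lattice_axioms.intro)
  interpret Ext: bounded_lattice Ext by (rule Ext_bounded)
  fix A assume "A \<in> carrier Ext"
  then obtain k where "at_stage k A" using common_stage[of "{A}" "{}"] by auto
  then obtain \<epsilon> x where x: "x \<in> carrier L" "x \<sqsubseteq> a 0 k" "A = elt \<epsilon> k x"
    unfolding at_stage_def by blast
  obtain y where y: "y \<in> carrier L" "x \<sqinter> y = \<bottom>" "x \<squnion> y = a 0 k"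
    using sectionally_complemented_lattice.sectional_complement[OF assms, of x "a 0 k"] x
    by (auto simp: osum_def)
  have y_le: "y \<sqsubseteq> a 0 k" using join_right[of x y] x y by simp
  have "\<bottom>\<^bsub>Ext\<^esub> = elt False k \<bottom>"
    using Ext.bottom_eq[of "embed \<bottom>"] embed_bottom_least embed_closed[OF bottom_closed]
    by (simp add: embed_eq_elt[symmetric])
  moreover have "\<top>\<^bsub>Ext\<^esub> = elt True k (a 0 k)"
    using Ext.top_eq[of "elt True k (a 0 k)"] elt_le_top elt_closed by simp
  ultimately have "A \<sqinter>\<^bsub>Ext\<^esub> elt (\<not> \<epsilon>) k y = \<bottom>\<^bsub>Ext\<^esub>" "A \<squnion>\<^bsub>Ext\<^esub> elt (\<not> \<epsilon>) k y = \<top>\<^bsub>Ext\<^esub>"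
    using x y y_le by (simp_all add: elt_meet elt_join)
  moreover have "elt (\<not> \<epsilon>) k y \<in> carrier Ext" using elt_closed[OF y(1) y_le] by simp
  ultimately show "\<exists>B\<in>carrier Ext. A \<sqinter>\<^bsub>Ext\<^esub> B = \<bottom>\<^bsub>Ext\<^esub> \<and> A \<squnion>\<^bsub>Ext\<^esub> B = \<top>\<^bsub>Ext\<^esub>"
    by (intro bexI[of _ "elt (\<not> \<epsilon>) k y"] conjI)
qed

lemma embed_ideal: "lattice_ideal Ext (embed ` carrier L)"
proof (rule RP.lattice_idealI)
  show "embed ` carrier L \<subseteq> carrier Ext" using embed_closed by auto
  show "embed \<bottom> \<in> embed ` carrier L" by simp
  show "A \<squnion>\<^bsub>Ext\<^esub> B \<in> embed ` carrier L" if "A \<in> embed ` carrier L" "B \<in> embed ` carrier L" for A B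
    using that by (auto simp: embed_join[symmetric])
  \<comment> \<open>The meet of a finite element with any element is finite.\<close>
  fix A B assume A: "A \<in> embed ` carrier L" and B: "B \<in> carrier Ext" "B \<sqsubseteq>\<^bsub>Ext\<^esub> A"
  obtain x where x: "x \<in> carrier L" "A = embed x" using A by blast
  obtain k where "at_stage k B" "x \<sqsubseteq> a 0 k" using common_stage[of "{B}" "{x}"] B x by auto
  then obtain \<epsilon> y where y: "y \<in> carrier L" "y \<sqsubseteq> a 0 k" "B = elt \<epsilon> k y" and k: "x \<sqsubseteq> a 0 k"
    unfolding at_stage_def by blast
  have "B = B \<sqinter>\<^bsub>Ext\<^esub> A" using RP.meet_absorb(1)[OF B(2)] B(1) x embed_closed by simp
  also have "\<dots> = elt \<epsilon> k y \<sqinter>\<^bsub>Ext\<^esub> elt False k x" using x y by (simp add: embed_eq_elt[of x k])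
  also have "\<dots> = embed (y \<sqinter> x)" using x y k by (simp add: elt_meet embed_eq_elt[of _ k])
  finally show "B \<in> embed ` carrier L" using x y by simp
qed

text \<open>At a common stage \<open>k\<close>, the finite parts of \<open>A\<close> and \<open>B\<close> are the embedded \<open>x\<close> and \<open>y\<close>, and a finite \<open>C\<close>
  below \<open>A \<squnion> B\<close> is already below \<open>x \<squnion> y\<close>.  For the dual law, whatever lies below both
  \<open>J \<squnion> A\<close> and \<open>J \<squnion> B\<close> with \<open>J\<close> finite is below the finite element \<open>a 0 k\<close> joined with the common tail
  of \<open>A\<close> and \<open>B\<close>.\<close>

lemma embed_neutral_ideal: "neutral_ideal Ext (embed ` carrier L)"
proof -
  interpret Ext: modular_lattice Ext
    by (rule reduced_power_modular) (rule modular_lattice_axioms)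
  show ?thesis
  proof (rule Ext.neutral_idealI[OF embed_ideal])
    fix A B C assume AB: "A \<in> carrier Ext" "B \<in> carrier Ext" and "C \<in> embed ` carrier L"
      and le: "C \<sqsubseteq>\<^bsub>Ext\<^esub> A \<squnion>\<^bsub>Ext\<^esub> B"
    then obtain z where z: "z \<in> carrier L" "C = embed z" by blast
    obtain k where k: "at_stage k A" "at_stage k B" "z \<sqsubseteq> a 0 k"
      using common_stage[of "{A, B}" "{z}"] AB z by auto
    then obtain \<epsilon> x \<delta> y where *: "x \<in> carrier L" "x \<sqsubseteq> a 0 k" "A = elt \<epsilon> k x"
      "y \<in> carrier L" "y \<sqsubseteq> a 0 k" "B = elt \<delta> k y" unfolding at_stage_def by blast
    have xy: "x \<squnion> y \<sqsubseteq> a 0 k" using * by (simp add: join_le)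
    have "embed z = embed z \<sqinter>\<^bsub>Ext\<^esub> (A \<squnion>\<^bsub>Ext\<^esub> B)"
      using RP.meet_absorb(1)[OF le] RP.join_closed[OF AB] z embed_closed by simp
    also have "\<dots> = embed (z \<sqinter> (x \<squnion> y))"
      using * xy k z by (simp add: elt_join elt_meet embed_eq_elt[of _ k])
    finally have "z \<sqsubseteq> x \<squnion> y" using z * meet_right[of z "x \<squnion> y"] by (simp add: embed_eq_iff)
    then have "C \<sqsubseteq>\<^bsub>Ext\<^esub> embed x \<squnion>\<^bsub>Ext\<^esub> embed y"
      using z * by (simp add: elt_join embed_eq_elt[of _ k] elt_mono)
    moreover have "embed x \<sqsubseteq>\<^bsub>Ext\<^esub> A" "embed y \<sqsubseteq>\<^bsub>Ext\<^esub> B"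
      using * by (simp_all add: embed_eq_elt[of _ k] elt_mono)
    ultimately show "\<exists>A'\<in>embed ` carrier L. \<exists>B'\<in>embed ` carrier L.
        A' \<sqsubseteq>\<^bsub>Ext\<^esub> A \<and> B' \<sqsubseteq>\<^bsub>Ext\<^esub> B \<and> C \<sqsubseteq>\<^bsub>Ext\<^esub> A' \<squnion>\<^bsub>Ext\<^esub> B'"
      using * by (intro bexI[of _ "embed x"] bexI[of _ "embed y"] conjI imageI)
  next
    fix A B C J assume ABC: "A \<in> carrier Ext" "B \<in> carrier Ext" "C \<in> carrier Ext"
      and "J \<in> embed ` carrier L"
      and le: "C \<sqsubseteq>\<^bsub>Ext\<^esub> J \<squnion>\<^bsub>Ext\<^esub> A" "C \<sqsubseteq>\<^bsub>Ext\<^esub> J \<squnion>\<^bsub>Ext\<^esub> B"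
    then obtain i where i: "i \<in> carrier L" "J = embed i" by blast
    have J: "J \<in> carrier Ext" using i embed_closed by simp
    obtain k where k: "at_stage k A" "at_stage k B" "i \<sqsubseteq> a 0 k"
      using common_stage[of "{A, B}" "{i}"] ABC i by auto
    then obtain \<epsilon> x \<delta> y where *: "x \<in> carrier L" "x \<sqsubseteq> a 0 k" "A = elt \<epsilon> k x"
      "y \<in> carrier L" "y \<sqsubseteq> a 0 k" "B = elt \<delta> k y" unfolding at_stage_def by blast
    have le_k: "i \<squnion> x \<sqsubseteq> a 0 k" "i \<squnion> y \<sqsubseteq> a 0 k" "\<bottom> \<sqsubseteq> a 0 k" "a 0 k \<sqsubseteq> a 0 k"
      using * i k by (simp_all add: join_le)
    let ?t = "elt (\<epsilon> \<and> \<delta>) k \<bottom>"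
    have "C \<sqsubseteq>\<^bsub>Ext\<^esub> (J \<squnion>\<^bsub>Ext\<^esub> A) \<sqinter>\<^bsub>Ext\<^esub> (J \<squnion>\<^bsub>Ext\<^esub> B)"
      by (rule RP.meet_le[OF le RP.join_closed[OF J ABC(1)] RP.join_closed[OF J ABC(2)] ABC(3)])
    also have "\<dots> = elt (\<epsilon> \<and> \<delta>) k ((i \<squnion> x) \<sqinter> (i \<squnion> y))"
      using * i k le_k by (simp add: elt_join elt_meet embed_eq_elt[of _ k])
    finally have "C \<sqsubseteq>\<^bsub>Ext\<^esub> elt (\<epsilon> \<and> \<delta>) k ((i \<squnion> x) \<sqinter> (i \<squnion> y))" .
    moreover have "elt (\<epsilon> \<and> \<delta>) k ((i \<squnion> x) \<sqinter> (i \<squnion> y)) \<sqsubseteq>\<^bsub>Ext\<^esub> elt (\<epsilon> \<and> \<delta>) k (a 0 k)"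
      using * i le_k by (intro elt_mono) (auto simp: meet_leI1)
    moreover have "elt (\<epsilon> \<and> \<delta>) k ((i \<squnion> x) \<sqinter> (i \<squnion> y)) \<in> carrier Ext"
      "elt (\<epsilon> \<and> \<delta>) k (a 0 k) \<in> carrier Ext"
      using * i le_k by (simp_all add: elt_closed meet_leI1)
    ultimately have "C \<sqsubseteq>\<^bsub>Ext\<^esub> elt (\<epsilon> \<and> \<delta>) k (a 0 k)"
      using RP.le_trans ABC(3) by simp
    also have "elt (\<epsilon> \<and> \<delta>) k (a 0 k) = embed (a 0 k) \<squnion>\<^bsub>Ext\<^esub> ?t"
      using le_k by (simp add: embed_eq_elt[of _ k] elt_join)
    finally have "C \<sqsubseteq>\<^bsub>Ext\<^esub> embed (a 0 k) \<squnion>\<^bsub>Ext\<^esub> ?t" .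
    moreover have "?t \<sqsubseteq>\<^bsub>Ext\<^esub> A" "?t \<sqsubseteq>\<^bsub>Ext\<^esub> B" using * by (simp_all add: elt_mono)
    moreover have "?t \<in> carrier Ext" using elt_closed le_k by simp
    ultimately show "\<exists>J'\<in>embed ` carrier L. \<exists>T\<in>carrier Ext.
        T \<sqsubseteq>\<^bsub>Ext\<^esub> A \<and> T \<sqsubseteq>\<^bsub>Ext\<^esub> B \<and> C \<sqsubseteq>\<^bsub>Ext\<^esub> J' \<squnion>\<^bsub>Ext\<^esub> T"
      by (intro bexI[of _ "embed (a 0 k)"] bexI[of _ ?t] conjI imageI a0_closed)
  qed
qed

end

theorem corollary5p4:
  fixes L :: "('a, 'b) gorder_scheme"
  assumes "sectionally_complemented_lattice L"
    and "modular_lattice L"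
    and "\<exists>U. countable U \<and> cofinal_subset L U"
  shows "(\<exists>(\<Lambda> :: nat gorder) a. banaschewski_trace L \<Lambda> a) \<and>
    (\<exists>(M :: (nat \<Rightarrow> 'a) set gorder) \<epsilon>.
       complemented_lattice M \<and> modular_lattice M \<and>
       (\<forall>Q. in_quasivariety L Q \<longrightarrow> in_quasivariety M Q) \<and>
       lattice_embedding L M \<epsilon> \<and>
       neutral_ideal M (\<epsilon> ` carrier L))"
proof -
  obtain a where trace: "banaschewski_trace L nat_order a"
    using banaschewski_trace_exists[OF assms(1,2)] assms(3) by blast
  interpret nat_trace L a
    by (intro nat_trace.intro nat_trace_axioms.intro bounded_below_modular_lattice.intro
        sectionally_complemented_lattice.axioms(2)[OF assms(1)] assms(2) trace)
  show ?thesis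
  proof (intro conjI exI)
    show "banaschewski_trace L nat_order a" by (rule trace)
    show "complemented_lattice Ext" by (rule Ext_complemented[OF assms(1)])
    show "modular_lattice Ext" by (rule reduced_power_modular[OF assms(2)])
    show "\<forall>Q. in_quasivariety L Q \<longrightarrow> in_quasivariety Ext Q"
      using reduced_power_in_quasivariety by simp
    show "lattice_embedding L Ext embed" by (rule embed_lattice_embedding)
    show "neutral_ideal Ext (embed ` carrier L)" by (rule embed_neutral_ideal)
  qed
qed

end
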